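(* Let $\Delta\mathbf G$ be a crossed simplicial group and let $(G_0,\lambda_0)$ be its associated group with parity. Then the canonical functor $\lambda\colon\Delta\mathbf G\to\Delta\mathbf H$ to the hyperoctahedral crossed simplicial group has a canonical factorization through a functor $\widetilde\lambda\colon\Delta\mathbf G\to\Delta\lambda_0\wr\mathbf\Sigma$ (the canonical functor $\widetilde\lambda$ being the identity on $\Delta$ and given on automorphisms by the maps $L_n$).
   Context: \textbf{Crossed simplicial group.} A small category $\Delta\mathbf G$ with objects $[n]$, $n\ge0$, containing the simplex category $\Delta$ as a wide subcategory, with $\mathrm{Aut}([n])=G_n^{\mathrm{op}}$ for groups $G_n$, such that each morphism $[n]\to[m]$ factors uniquely as $\phi\circ g$ with $\phi\in\Delta([n],[m])$, $g\in G_n^{\mathrm{op}}$. For $g\in G_m$, $\phi\in\Delta([n],[m])$ write $g\circ\phi=(g^*\phi)\circ(\phi^*g)$ with $g^*\phi\in\Delta([n],[m])$, $\phi^*g\in G_n$. Let $\phi_i\colon[0]\to[n]$ send $0$ to $i$, and for $g\in G_n$ define $\theta_g\in\Sigma_{n+1}$ by $g^*\phi_i=\phi_{\theta_g^{-1}(i)}$; the assignment $g\mapsto\theta_g$ is a homomorphism $G_n\to\Sigma_{n+1}$. \textbf{Associated parity.} $\lambda_0\colon G_0\to C_2=\{1,-1\}$ is $\lambda_0(g)=1$ if $(\sigma_0^*g)^*(\delta_0)=\delta_0$ and $-1$ if $(\sigma_0^*g)^*(\delta_0)=\delta_1$, where $\sigma_0\colon[1]\to[0]$ and $\delta_i\colon[0]\to[1]$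 skips $i$. \textbf{Twisted symmetric crossed simplicial group.} For a group $G$ with parity $\varphi\colon G\to C_2$, $\Delta\varphi\wr\mathbf\Sigma$ is the crossed simplicial group with groups $G\wr\Sigma_{n+1}$, multiplication $(g_i;\gamma)(g'_i;\gamma')=(g_ig'_{\gamma^{-1}(i)};\gamma\gamma')$, and for $\phi\colon[m]\to[n]$ in $\Delta$: $(g_0,\dots,g_n;\gamma)^*\phi=\gamma^*\phi$ and $\phi^*(g_0,\dots,g_n;\gamma)=\phi^*(g_0,\dots,g_n;\mathrm{id})\cdot(e,\dots,e;\phi^*\gamma)$. Here $\gamma^*\phi\in\Delta([m],[n])$, $\phi^*\gamma\in\Sigma_{m+1}$ are the unique maps with $\gamma\circ\gamma^*\phi=\phi\circ\phi^*\gamma$ as set maps and $\phi^*\gamma$ order preserving on each $(\gamma^*\phi)^{-1}(j)$; and $\phi^*(g_0,\dots,g_n;\mathrm{id})$ repeats each $g_i$ $|\phi^{-1}(i)|$ times, with the permutation that is the identity on the block $\phi^{-1}(i)$ if $g_i$ is even and reverses it if $g_i$ is odd. The hyperoctahedral crossed simplicial group is $\Delta\mathbf H=\Delta\,\mathrm{id}_{C_2}\wr\mathbf\Sigma$. A homomorphism $f\colon G\to G'$ compatible with parities induces a functor $\Delta\varphi\wr\mathbf\Sigma\to\Delta\varphi'\wr\mathbf\Sigma$, identity on $\Delta$, $(g_i;\gamma)\mapsto(f(g_i);\gamma)$. \textbf{The functors.} A functor between crossed simplicial groups that is the identity on $\Delta$ is given by group homomorphisms $f_n\colon G_n\to G_n'$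 compatible with $\theta$, $\delta_i^*$ and $\sigma_i^*$. The canonical functor $\lambda$ (Fiedorowicz--Loday) is the identity on $\Delta$ and given on $G_n$ by $g\mapsto(\lambda_0(\phi_0^*g),\dots,\lambda_0(\phi_n^*g);\theta_g)\in C_2\wr\Sigma_{n+1}$. The map $L_n\colon G_n\to G_0\wr\Sigma_{n+1}$ is $L_n(g)=(\phi_0^*g,\dots,\phi_n^*g;\theta_g)$, which is a group homomorphism. The factorization is $\Delta\mathbf G\xrightarrow{\widetilde\lambda}\Delta\lambda_0\wr\mathbf\Sigma\to\Delta\mathbf H$, the second functor being induced by $\lambda_0$. *)

theory Defs
  imports "HOL-Library.FuncSet" "HOL-Combinatorics.Permutations" "HOL-Algebra.Sym_Groups"
begin

section \<open>Categories with objects $[0], [1], [2], \dots$\<close>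

text \<open>
  The object $[n]$ is represented by the natural number \<open>n\<close>. Hom-sets are indexed by source and
  target and need not be disjoint; accordingly \<open>cmp C m n k v u\<close> is the composite
  $v \circ u$ of $u : [m] \to [n]$ and $v : [n] \to [k]$.
\<close>

record 'a nat_cat =
  arrows :: "nat \<Rightarrow> nat \<Rightarrow> 'a set"
  cmp :: "nat \<Rightarrow> nat \<Rightarrow> nat \<Rightarrow> 'a \<Rightarrow> 'a \<Rightarrow> 'a"
  idn :: "nat \<Rightarrow> 'a"

locale nat_category =
  fixes C :: "('a, 'b) nat_cat_scheme"
  assumes idn_in: "idn C n \<in> arrows C n n"
    and cmp_in: "u \<in> arrows C m n \<Longrightarrow> v \<in> arrows C n k \<Longrightarrow> cmp C m n k v u \<in> arrows C m k"
    and cmp_idn_left: "u \<in> arrows C m n \<Longrightarrow> cmp C m n n (idn C n) u = u"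
    and cmp_idn_right: "u \<in> arrows C m n \<Longrightarrow> cmp C m m n u (idn C m) = u"
    and cmp_assoc: "u \<in> arrows C m n \<Longrightarrow> v \<in> arrows C n k \<Longrightarrow> w \<in> arrows C k l \<Longrightarrow>
      cmp C m n l (cmp C n k l w v) u = cmp C m k l w (cmp C m n k v u)"

text \<open>Functors that are the identity on objects.\<close>

locale nat_functor = source: nat_category C + target: nat_category D
  for C :: "('a, 'b) nat_cat_scheme" and D :: "('c, 'd) nat_cat_scheme" +
  fixes F :: "nat \<Rightarrow> nat \<Rightarrow> 'a \<Rightarrow> 'c"
  assumes map_in: "u \<in> arrows C m n \<Longrightarrow> F m n u \<in> arrows D m n"
    and map_idn: "F n n (idn C n) = idn D n"
    and map_cmp: "u \<in> arrows C m n \<Longrightarrow> v \<in> arrows C n k \<Longrightarrow>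
      F m k (cmp C m n k v u) = cmp D m n k (F n k v) (F m n u)"

definition Aut_group :: "('a, 'b) nat_cat_scheme \<Rightarrow> nat \<Rightarrow> 'a monoid" where
  "Aut_group C n =
    \<lparr> carrier = {u \<in> arrows C n n. \<exists>v \<in> arrows C n n.
        cmp C n n n v u = idn C n \<and> cmp C n n n u v = idn C n},
      mult = cmp C n n n,
      one = idn C n \<rparr>"

definition opposite_group :: "'g monoid \<Rightarrow> 'g monoid" where
  "opposite_group G = \<lparr> carrier = carrier G, mult = (\<lambda>x y. y \<otimes>\<^bsub>G\<^esub> x), one = \<one>\<^bsub>G\<^esub> \<rparr>"


section \<open>The simplex category\<close>

text \<open>Extensional functions make equality of arrows the same as equality of functions.\<close>

definition Delta :: "nat \<Rightarrow> nat \<Rightarrow> (nat \<Rightarrow> nat) set" where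
  "Delta m n = {\<phi> \<in> {..m} \<rightarrow>\<^sub>E {..n}. mono_on {..m} \<phi>}"

definition simplex_category :: "(nat \<Rightarrow> nat) nat_cat" where
  "simplex_category =
    \<lparr> arrows = Delta,
      cmp = (\<lambda>m n k \<psi> \<phi>. compose {..m} \<psi> \<phi>),
      idn = (\<lambda>n. restrict id {..n}) \<rparr>"

text \<open>The map $\phi_i : [0] \to [n]$ with $0 \mapsto i$; as a function it does not depend on $n$.\<close>

definition vertex :: "nat \<Rightarrow> nat \<Rightarrow> nat" where
  "vertex i = (\<lambda>x\<in>{..0}. i)"

text \<open>\<open>coface0 i\<close> is $\delta_i : [0] \to [1]$, which skips \<open>i\<close>; \<open>codegeneracy0\<close> is
  $\sigma_0 : [1] \to [0]$.\<close>

definition coface0 :: "nat \<Rightarrow> nat \<Rightarrow> nat" where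
  "coface0 i = (\<lambda>x\<in>{..0}. if x < i then x else Suc x)"

definition codegeneracy0 :: "nat \<Rightarrow> nat" where
  "codegeneracy0 = (\<lambda>x\<in>{..1}. 0)"


section \<open>Crossed simplicial groups\<close>

text \<open>
  \<open>incl\<close> identifies the simplex category with a wide subcategory, \<open>grp n\<close> is the group
  $G_n$, and \<open>aut n\<close> is the identification of the opposite group of $G_n$ with the automorphism
  group of $[n]$. Hence a product $g h$ in $G_n$ acts as the composite $h \circ g$ of arrows.
\<close>

record ('a, 'g) csg = "'a nat_cat" +
  incl :: "nat \<Rightarrow> nat \<Rightarrow> (nat \<Rightarrow> nat) \<Rightarrow> 'a"
  grp :: "nat \<Rightarrow> 'g monoid"
  aut :: "nat \<Rightarrow> 'g \<Rightarrow> 'a"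

locale crossed_simplicial_group =
  nat_category X + incl: nat_functor simplex_category X "incl X"
  for X :: "('a, 'g) csg" +
  assumes incl_inj: "inj_on (incl X m n) (Delta m n)"
    and group_grp: "group (grp X n)"
    and aut_iso: "aut X n \<in> iso (opposite_group (grp X n)) (Aut_group X n)"
    and unique_factorization: "u \<in> arrows X m n \<Longrightarrow>
      \<exists>!(\<phi>, g). \<phi> \<in> Delta m n \<and> g \<in> carrier (grp X m) \<and>
        u = cmp X m m n (incl X m n \<phi>) (aut X m g)"

definition factorization ::
    "('a, 'g) csg \<Rightarrow> nat \<Rightarrow> nat \<Rightarrow> 'a \<Rightarrow> (nat \<Rightarrow> nat) \<times> 'g" where
  "factorization X m n u =
    (THE (\<phi>, g). \<phi> \<in> Delta m n \<and> g \<in> carrier (grp X m) \<and>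
      u = cmp X m m n (incl X m n \<phi>) (aut X m g))"

text \<open>
  For $g \in G_n$ and $\phi : [m] \to [n]$ in the simplex category, \<open>act X m n g \<phi>\<close> is $g^*\phi$ and
  \<open>pull X m n \<phi> g\<close> is $\phi^*g$.
\<close>

definition act :: "('a, 'g) csg \<Rightarrow> nat \<Rightarrow> nat \<Rightarrow> 'g \<Rightarrow> (nat \<Rightarrow> nat) \<Rightarrow> (nat \<Rightarrow> nat)" where
  "act X m n g \<phi> = fst (factorization X m n (cmp X m n n (aut X n g) (incl X m n \<phi>)))"

definition pull :: "('a, 'g) csg \<Rightarrow> nat \<Rightarrow> nat \<Rightarrow> (nat \<Rightarrow> nat) \<Rightarrow> 'g \<Rightarrow> 'g" where
  "pull X m n \<phi> g = snd (factorization X m n (cmp X m n n (aut X n g) (incl X m n \<phi>)))"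

definition theta :: "('a, 'g) csg \<Rightarrow> nat \<Rightarrow> 'g \<Rightarrow> (nat \<Rightarrow> nat)" where
  "theta X n g = (THE p. p permutes {..n} \<and>
    (\<forall>i\<le>n. act X 0 n g (vertex i) = vertex (Hilbert_Choice.inv p i)))"

text \<open>The group $C_2$ is \<^const>\<open>sign_img\<close>, whose carrier is $\{-1, 1\}$. A parity is a homomorphism
  into it; even elements have parity $1$ and odd ones parity $-1$.\<close>

definition lambda0 :: "('a, 'g) csg \<Rightarrow> 'g \<Rightarrow> int" where
  "lambda0 X g =
    (let \<alpha> = act X 0 1 (pull X 1 0 codegeneracy0 g) (coface0 0)
     in if \<alpha> = coface0 0 then 1 else if \<alpha> = coface0 1 then -1 else undefined)"


section \<open>Twisted symmetric crossed simplicial groups\<close>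

text \<open>
  The crossed simplicial group assembled from groups $K_n$ and the operations
  $(g, \phi) \mapsto g^*\phi$ and $(\phi, g) \mapsto \phi^*g$ (arguments as for \<^const>\<open>act\<close> and
  \<^const>\<open>pull\<close>). The pair \<open>(\<phi>, g)\<close> stands for $\phi \circ g$, so that
  $(\psi \circ h) \circ (\phi \circ g) = (\psi \circ h^*\phi) \circ (\phi^*h \circ g)$, and the last
  composite is the product $g \cdot \phi^*h$ in the group, because of the opposite.
\<close>

definition crossed_product ::
    "(nat \<Rightarrow> 'k monoid) \<Rightarrow> (nat \<Rightarrow> nat \<Rightarrow> 'k \<Rightarrow> (nat \<Rightarrow> nat) \<Rightarrow> (nat \<Rightarrow> nat)) \<Rightarrow>
     (nat \<Rightarrow> nat \<Rightarrow> (nat \<Rightarrow> nat) \<Rightarrow> 'k \<Rightarrow> 'k) \<Rightarrow> ((nat \<Rightarrow> nat) \<times> 'k, 'k) csg" where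
  "crossed_product K a p =
    \<lparr> arrows = (\<lambda>m n. Delta m n \<times> carrier (K m)),
      cmp = (\<lambda>m n k (\<psi>, h) (\<phi>, g). (compose {..m} \<psi> (a m n h \<phi>), g \<otimes>\<^bsub>K m\<^esub> p m n \<phi> h)),
      idn = (\<lambda>n. (restrict id {..n}, \<one>\<^bsub>K n\<^esub>)),
      incl = (\<lambda>m n \<phi>. (\<phi>, \<one>\<^bsub>K m\<^esub>)),
      grp = K,
      aut = (\<lambda>n g. (restrict id {..n}, g)) \<rparr>"

text \<open>\<open>wreath G n\<close> is $G \wr \Sigma_{n+1}$, with $\Sigma_{n+1}$ acting on $\{0, \dots, n\}$.\<close>

type_synonym 'g wreath = "(nat \<Rightarrow> 'g) \<times> (nat \<Rightarrow> nat)"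

definition wreath :: "'g monoid \<Rightarrow> nat \<Rightarrow> 'g wreath monoid" where
  "wreath G n =
    \<lparr> carrier = ({..n} \<rightarrow>\<^sub>E carrier G) \<times> {\<gamma>. \<gamma> permutes {..n}},
      mult = (\<lambda>(g, \<gamma>) (g', \<gamma>').
        (\<lambda>i\<in>{..n}. g i \<otimes>\<^bsub>G\<^esub> g' (Hilbert_Choice.inv \<gamma> i), \<gamma> \<circ> \<gamma>')),
      one = (\<lambda>i\<in>{..n}. \<one>\<^bsub>G\<^esub>, id) \<rparr>"

text \<open>For a permutation \<open>\<gamma>\<close> of $[n]$ and \<open>\<phi>\<close> in \<open>Delta m n\<close>, the pair
  $(\gamma^*\phi, \phi^*\gamma)$.\<close>

definition sym_cross ::
    "nat \<Rightarrow> nat \<Rightarrow> (nat \<Rightarrow> nat) \<Rightarrow> (nat \<Rightarrow> nat) \<Rightarrow> (nat \<Rightarrow> nat) \<times> (nat \<Rightarrow> nat)" where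
  "sym_cross m n \<gamma> \<phi> =
    (THE (\<psi>, p). \<psi> \<in> Delta m n \<and> p permutes {..m} \<and>
      (\<forall>j\<le>m. \<gamma> (\<psi> j) = \<phi> (p j)) \<and>
      (\<forall>i\<le>n. mono_on {j \<in> {..m}. \<psi> j = i} p))"

text \<open>The permutation of $[m]$ preserving every block $\phi^{-1}(i)$, which is the identity on it if
  $g_i$ is even and reverses it if $g_i$ is odd; the blocks are intervals as \<open>\<phi>\<close> is monotone.\<close>

definition block_reversal ::
    "('g \<Rightarrow> int) \<Rightarrow> nat \<Rightarrow> (nat \<Rightarrow> nat) \<Rightarrow> (nat \<Rightarrow> 'g) \<Rightarrow> (nat \<Rightarrow> nat)" where
  "block_reversal par m \<phi> g j =
    (if j \<le> m \<and> par (g (\<phi> j)) = -1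
     then Min {k \<in> {..m}. \<phi> k = \<phi> j} + Max {k \<in> {..m}. \<phi> k = \<phi> j} - j
     else j)"

definition twisted_act ::
    "nat \<Rightarrow> nat \<Rightarrow> 'g wreath \<Rightarrow> (nat \<Rightarrow> nat) \<Rightarrow> (nat \<Rightarrow> nat)" where
  "twisted_act m n = (\<lambda>(g, \<gamma>) \<phi>. fst (sym_cross m n \<gamma> \<phi>))"

definition twisted_pull ::
    "'g monoid \<Rightarrow> ('g \<Rightarrow> int) \<Rightarrow> nat \<Rightarrow> nat \<Rightarrow> (nat \<Rightarrow> nat) \<Rightarrow> 'g wreath \<Rightarrow> 'g wreath" where
  "twisted_pull G par m n \<phi> = (\<lambda>(g, \<gamma>).
    (\<lambda>j\<in>{..m}. g (\<phi> j), block_reversal par m \<phi> g)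
      \<otimes>\<^bsub>wreath G m\<^esub> (\<lambda>j\<in>{..m}. \<one>\<^bsub>G\<^esub>, snd (sym_cross m n \<gamma> \<phi>)))"

definition twisted_symmetric ::
    "'g monoid \<Rightarrow> ('g \<Rightarrow> int) \<Rightarrow> ((nat \<Rightarrow> nat) \<times> 'g wreath, 'g wreath) csg" where
  "twisted_symmetric G par = crossed_product (wreath G) twisted_act (twisted_pull G par)"

definition hyperoctahedral :: "((nat \<Rightarrow> nat) \<times> int wreath, int wreath) csg" where
  "hyperoctahedral = twisted_symmetric sign_img id"


section \<open>Functors between crossed simplicial groups\<close>

text \<open>Functors that are the identity on the simplex category and are given by the homomorphisms
  $f_n$ on automorphisms.\<close>

locale csg_functor =
  source_csg: crossed_simplicial_group X + target_csg: crossed_simplicial_group Y +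
  nat_functor X Y F
  for X :: "('a, 'g) csg" and Y :: "('b, 'h) csg"
    and f :: "nat \<Rightarrow> 'g \<Rightarrow> 'h" and F :: "nat \<Rightarrow> nat \<Rightarrow> 'a \<Rightarrow> 'b" +
  assumes hom_component: "f n \<in> hom (grp X n) (grp Y n)"
    and map_incl: "\<phi> \<in> Delta m n \<Longrightarrow> F m n (incl X m n \<phi>) = incl Y m n \<phi>"
    and map_aut: "g \<in> carrier (grp X n) \<Longrightarrow> F n n (aut X n g) = aut Y n (f n g)"

text \<open>Such a functor can only be $\phi \circ g \mapsto \phi \circ f_m(g)$ on arrows out of $[m]$.\<close>

definition induced_functor ::
    "('a, 'g) csg \<Rightarrow> ('b, 'h) csg \<Rightarrow> (nat \<Rightarrow> 'g \<Rightarrow> 'h) \<Rightarrow> nat \<Rightarrow> nat \<Rightarrow> 'a \<Rightarrow> 'b" where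
  "induced_functor X Y f m n u =
    (let (\<phi>, g) = factorization X m n u in cmp Y m m n (incl Y m n \<phi>) (aut Y m (f m g)))"

definition wreath_map :: "('g \<Rightarrow> 'h) \<Rightarrow> nat \<Rightarrow> 'g wreath \<Rightarrow> 'h wreath" where
  "wreath_map f n = (\<lambda>(g, \<gamma>). (\<lambda>i\<in>{..n}. f (g i), \<gamma>))"

definition fl_component :: "('a, 'g) csg \<Rightarrow> nat \<Rightarrow> 'g \<Rightarrow> int wreath" where
  "fl_component X n g = (\<lambda>i\<in>{..n}. lambda0 X (pull X 0 n (vertex i) g), theta X n g)"

definition L_map :: "('a, 'g) csg \<Rightarrow> nat \<Rightarrow> 'g \<Rightarrow> 'g wreath" where
  "L_map X n g = (\<lambda>i\<in>{..n}. pull X 0 n (vertex i) g, theta X n g)"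

text \<open>The canonical functor of Fiedorowicz and Loday.\<close>

definition canonical_lambda ::
    "('a, 'g) csg \<Rightarrow> nat \<Rightarrow> nat \<Rightarrow> 'a \<Rightarrow> (nat \<Rightarrow> nat) \<times> int wreath" where
  "canonical_lambda X = induced_functor X hyperoctahedral (fl_component X)"

definition associated_twisted_symmetric ::
    "('a, 'g) csg \<Rightarrow> ((nat \<Rightarrow> nat) \<times> 'g wreath, 'g wreath) csg" where
  "associated_twisted_symmetric X = twisted_symmetric (grp X 0) (lambda0 X)"

definition canonical_lambda_tilde ::
    "('a, 'g) csg \<Rightarrow> nat \<Rightarrow> nat \<Rightarrow> 'a \<Rightarrow> (nat \<Rightarrow> nat) \<times> 'g wreath" where
  "canonical_lambda_tilde X = induced_functor X (associated_twisted_symmetric X) (L_map X)"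

definition twisted_symmetric_map ::
    "'g monoid \<Rightarrow> ('g \<Rightarrow> int) \<Rightarrow> 'h monoid \<Rightarrow> ('h \<Rightarrow> int) \<Rightarrow> ('g \<Rightarrow> 'h) \<Rightarrow>
     nat \<Rightarrow> nat \<Rightarrow> (nat \<Rightarrow> nat) \<times> 'g wreath \<Rightarrow> (nat \<Rightarrow> nat) \<times> 'h wreath" where
  "twisted_symmetric_map G par H par' f =
    induced_functor (twisted_symmetric G par) (twisted_symmetric H par') (wreath_map f)"

definition parity_functor ::
    "('a, 'g) csg \<Rightarrow> nat \<Rightarrow> nat \<Rightarrow> (nat \<Rightarrow> nat) \<times> 'g wreath \<Rightarrow> (nat \<Rightarrow> nat) \<times> int wreath" where
  "parity_functor X = twisted_symmetric_map (grp X 0) (lambda0 X) sign_img id (lambda0 X)"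

end

theory Submission
  imports Defs
begin

text \<open>
  A crossing of a permutation $\gamma$ of $[n]$ with $\phi : [m] \to [n]$ is a pair $(\psi, q)$ with
  $\gamma \psi = \phi q$, $\psi$ monotone, and $q$ increasing or decreasing on each fibre of $\psi$
  as prescribed by a set of odd indices. Such a pair is unique: $q^{-1}$ sorts $[m]$
  lexicographically by $\gamma^{-1} \phi$ and then by the natural or reversed order of the fibres.
  Hence every identity in a twisted symmetric crossed simplicial group only requires a check that
  crossings compose. In an arbitrary crossed simplicial group, restriction of
  $g \circ \phi = g^*\phi \circ \phi^*g$ to vertices and to edges inside the fibres of $\phi$ shows
  that $(g^*\phi, \theta_{\phi^*g})$ is the crossing of $\theta_g$ with $\phi$ in which $k$ is odd
  iff $\lambda_0(\phi_k^*g) = -1$. By uniqueness the maps $L_n$ are compatible with the crossed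
  structure.
\<close>

section \<open>The simplex category\<close>

text \<open>The given formulas do not combine well: \<open>sym_cross\<close> and
  \<open>theta\<close> are definite descriptions, and \<open>twisted_pull\<close> multiplies a
  sorting permutation by block reversals. With \<open>fibre_cross\<close>, a value is never computed
  but recognised. The odd indices live on the target of \<phi> because the labels g_k do:
  multiplying crossings changes parities by an exclusive or with a shift by the inverse of \<gamma>,
  and composing simplicial maps pulls them back along \<phi>, just as the wreath product and the
  repetition of labels do. Inverses and reversed products come from one convention: g h acts as the
  composite of g followed by h, so g^*\<phi> is a right action, and \<theta>_g is the inverse of the
  induced permutation of vertices. One homomorphism \<lambda>_0 governs all fibres because an edge
  collapsed by \<phi> becomes, after applying \<phi>, a vertex composed with \<sigma>_0.
  Functoriality of \<lambda> is not presupposed: it follows from L_n followed by \<lambda>_0 on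
  labels, so the triangle commutes strictly.\<close>

lemma Delta_iff:
  "\<phi> \<in> Delta m n \<longleftrightarrow>
    \<phi> \<in> extensional {..m} \<and> (\<forall>j\<le>m. \<phi> j \<le> n) \<and> (\<forall>i\<le>m. \<forall>j\<le>m. i \<le> j \<longrightarrow> \<phi> i \<le> \<phi> j)"
  by (auto simp: Delta_def PiE_iff mono_on_def)

lemma Delta_le: "\<phi> \<in> Delta m n \<Longrightarrow> j \<le> m \<Longrightarrow> \<phi> j \<le> n"
  by (simp add: Delta_iff)

lemma Delta_mono: "\<phi> \<in> Delta m n \<Longrightarrow> i \<le> j \<Longrightarrow> j \<le> m \<Longrightarrow> \<phi> i \<le> \<phi> j"
  by (simp add: Delta_iff)

lemma Delta_eqI:
  "\<phi> \<in> Delta m n \<Longrightarrow> \<psi> \<in> Delta m n \<Longrightarrow> (\<And>j. j \<le> m \<Longrightarrow> \<phi> j = \<psi> j) \<Longrightarrow> \<phi> = \<psi>"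
  by (rule extensionalityI[of _ "{..m}"]) (auto simp: Delta_iff)

lemma id_in_Delta: "restrict id {..n} \<in> Delta n n"
  by (simp add: Delta_iff)

lemma compose_in_Delta:
  "\<phi> \<in> Delta m n \<Longrightarrow> \<psi> \<in> Delta n k \<Longrightarrow> compose {..m} \<psi> \<phi> \<in> Delta m k"
  by (simp add: Delta_iff compose_eq)

lemma compose_apply: "j \<le> m \<Longrightarrow> compose {..m} \<psi> \<phi> j = \<psi> (\<phi> j)"
  by (simp add: compose_eq)

lemma compose_Delta_id: "\<phi> \<in> Delta m n \<Longrightarrow> compose {..m} \<phi> (restrict id {..m}) = \<phi>"
  by (rule extensionalityI[of _ "{..m}"]) (auto simp: Delta_iff compose_eq)

lemma id_compose_Delta: "\<phi> \<in> Delta m n \<Longrightarrow> compose {..m} (restrict id {..n}) \<phi> = \<phi>"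
  by (rule extensionalityI[of _ "{..m}"]) (auto simp: Delta_iff compose_eq)

lemma compose_Delta_assoc:
  "\<phi> \<in> Delta m n \<Longrightarrow> compose {..m} (compose {..n} \<chi> \<psi>) \<phi> = compose {..m} \<chi> (compose {..m} \<psi> \<phi>)"
  by (rule extensionalityI[of _ "{..m}"]) (auto simp: Delta_iff compose_eq)

lemma simplex_category_simps [simp]:
  "arrows simplex_category = Delta"
  "cmp simplex_category m n k \<psi> \<phi> = compose {..m} \<psi> \<phi>"
  "idn simplex_category n = restrict id {..n}"
  by (simp_all add: simplex_category_def)

lemma nat_category_simplex: "nat_category simplex_category"
  by unfold_locales
    (simp_all add: id_in_Delta compose_in_Delta compose_Delta_id id_compose_Delta
      compose_Delta_assoc)

text \<open>A permutation of an initial segment takes every value below \<open>r b\<close> exactly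
  once, so \<open>r b\<close> is a rank. Hence the permutation is determined by the order relation
  that it induces on its domain.\<close>

lemma permutes_atMost_eq_card:
  assumes "r permutes {..m::nat}" and "b \<le> m"
  shows "r b = card {a. a \<le> m \<and> r a < r b}"
proof -
  have "r ` {a. a \<le> m \<and> r a < r b} = {..<r b}"
  proof (intro Set.set_eqI iffI)
    fix y assume "y \<in> {..<r b}"
    moreover have "r b \<le> m"
      using assms permutes_in_image[of r "{..m}" b] by simp
    ultimately have "y \<in> r ` {..m}"
      using permutes_image[OF assms(1)] by auto
    with \<open>y \<in> {..<r b}\<close> show "y \<in> r ` {a. a \<le> m \<and> r a < r b}" by auto
  qed auto
  then have "card {..<r b} = card {a. a \<le> m \<and> r a < r b}"
    by (metis card_image permutes_inj_on[OF assms(1)])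
  then show ?thesis by simp
qed

text \<open>A monotone bijection preserves ranks. This will show that an invertible arrow of a
  crossed product has trivial simplicial part.\<close>

lemma Delta_surj_eq_id:
  assumes "\<phi> \<in> Delta n n" and surj: "\<And>i. i \<le> n \<Longrightarrow> \<exists>j\<le>n. \<phi> j = i"
  shows "\<phi> = restrict id {..n}"
proof (rule Delta_eqI[OF assms(1) id_in_Delta])
  fix j assume j: "j \<le> n"
  \<comment> \<open>\<open>\<phi>\<close> is extensional, hence \<open>undefined\<close> beyond
    \<open>n\<close>, whereas \<open>permutes\<close> demands fixed points there.\<close>
  define r where "r i = (if i \<le> n then \<phi> i else i)" for i
  have onto: "r ` {..n} = {..n}"
    using surj Delta_le[OF assms(1)] by (fastforce simp: r_def image_iff)
  then have inj: "inj_on r {..n}"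
    by (simp add: eq_card_imp_inj_on)
  have perm: "r permutes {..n}"
    using onto inj by (intro bij_imp_permutes) (auto simp: bij_betw_def r_def)
  have "{a. a \<le> n \<and> r a < r j} = {..<j}"
  proof (intro Set.set_eqI iffI)
    fix a assume "a \<in> {a. a \<le> n \<and> r a < r j}"
    then show "a \<in> {..<j}"
      using Delta_mono[OF assms(1), of j a] j by (cases "a < j") (auto simp: r_def)
  next
    fix a assume a: "a \<in> {..<j}"
    then have "r a \<le> r j"
      using Delta_mono[OF assms(1), of a j] j by (auto simp: r_def)
    moreover have "r a \<noteq> r j"
      using a j inj by (auto dest: inj_onD)
    ultimately show "a \<in> {a. a \<le> n \<and> r a < r j}" using a j by auto
  qed
  then have "r j = j" using permutes_atMost_eq_card[OF perm j] by simp
  then show "\<phi> j = restrict id {..n} j" using j by (simp add: r_def)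
qed

section \<open>Crossings of permutations with simplicial maps\<close>

text \<open>The set \<open>{k. \<epsilon> k}\<close> of odd indices is indexed by the target of \<open>\<phi>\<close>, and the fibre of \<open>\<psi>\<close>
  over \<open>i\<close> is sent to the fibre of \<open>\<phi>\<close> over \<open>\<gamma> i\<close>.\<close>

definition fibre_cross ::
    "nat \<Rightarrow> nat \<Rightarrow> (nat \<Rightarrow> bool) \<Rightarrow> (nat \<Rightarrow> nat) \<Rightarrow> (nat \<Rightarrow> nat) \<Rightarrow> (nat \<Rightarrow> nat) \<Rightarrow> (nat \<Rightarrow> nat) \<Rightarrow> bool"
  where
  "fibre_cross m n \<epsilon> \<gamma> \<phi> \<psi> q \<longleftrightarrow>
    \<psi> \<in> Delta m n \<and> q permutes {..m} \<and> (\<forall>j\<le>m. \<gamma> (\<psi> j) = \<phi> (q j)) \<and>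
    (\<forall>i\<le>m. \<forall>j\<le>m. i < j \<longrightarrow> \<psi> i = \<psi> j \<longrightarrow> (q i < q j \<longleftrightarrow> \<not> \<epsilon> (\<phi> (q i))))"

text \<open>For a permutation \<open>\<gamma>\<close> the test \<open>\<phi> a = \<phi> b\<close> is
  the tie case of the first comparison.\<close>

definition cross_less :: "(nat \<Rightarrow> bool) \<Rightarrow> (nat \<Rightarrow> nat) \<Rightarrow> (nat \<Rightarrow> nat) \<Rightarrow> nat \<Rightarrow> nat \<Rightarrow> bool" where
  "cross_less \<epsilon> \<gamma> \<phi> a b \<longleftrightarrow>
    Hilbert_Choice.inv \<gamma> (\<phi> a) < Hilbert_Choice.inv \<gamma> (\<phi> b) \<or>
    \<phi> a = \<phi> b \<and> (if \<epsilon> (\<phi> a) then b < a else a < b)"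

lemma permutes_atMost_le: "p permutes {..n::nat} \<Longrightarrow> j \<le> n \<Longrightarrow> p j \<le> n"
  using permutes_in_image[of p "{..n}" j] by simp

text \<open>The position of \<open>a\<close> lies in the fibre of \<open>\<psi>\<close> over the
  preimage of \<open>\<phi> a\<close> under \<open>\<gamma>\<close>. Monotonicity of
  \<open>\<psi>\<close> orders different fibres, and parity orders a single one. The right-hand side
  mentions neither \<open>\<psi>\<close> nor \<open>q\<close>; this is the source of
  uniqueness.\<close>

lemma fibre_cross_inv_less_iff:
  assumes \<gamma>: "\<gamma> permutes {..n}" and cr: "fibre_cross m n \<epsilon> \<gamma> \<phi> \<psi> q" and ab: "a \<le> m" "b \<le> m"
  shows "Hilbert_Choice.inv q a < Hilbert_Choice.inv q b \<longleftrightarrow> cross_less \<epsilon> \<gamma> \<phi> a b"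
proof -
  have \<psi>: "\<psi> \<in> Delta m n" and q: "q permutes {..m}"
    and comm: "\<And>j. j \<le> m \<Longrightarrow> \<gamma> (\<psi> j) = \<phi> (q j)"
    and fib: "\<And>i j. i \<le> m \<Longrightarrow> j \<le> m \<Longrightarrow> i < j \<Longrightarrow> \<psi> i = \<psi> j \<Longrightarrow> q i < q j \<longleftrightarrow> \<not> \<epsilon> (\<phi> (q i))"
    using cr by (auto simp: fibre_cross_def)
  define i j where "i = Hilbert_Choice.inv q a" and "j = Hilbert_Choice.inv q b"
  have le: "i \<le> m" "j \<le> m"
    using permutes_atMost_le[OF permutes_inv[OF q]] ab by (auto simp: i_def j_def)
  have qi: "q i = a" "q j = b"
    using permutes_inverses[OF q] by (auto simp: i_def j_def)
  have \<psi>eq: "\<psi> i = Hilbert_Choice.inv \<gamma> (\<phi> a)" "\<psi> j = Hilbert_Choice.inv \<gamma> (\<phi> b)"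
    using comm[OF le(1)] comm[OF le(2)] qi permutes_inv_eq[OF \<gamma>] by metis+
  have fibeq: "\<psi> i = \<psi> j \<longleftrightarrow> \<phi> a = \<phi> b"
    using comm[OF le(1)] comm[OF le(2)] qi permutes_inj[OF \<gamma>] by (metis injD)
  consider "i = j" | "i < j" | "j < i" by linarith
  then have "i < j \<longleftrightarrow> \<psi> i < \<psi> j \<or> \<psi> i = \<psi> j \<and> (if \<epsilon> (\<phi> a) then b < a else a < b)"
  proof cases
    case 1
    then show ?thesis using qi by auto
  next
    case 2
    then have "a \<noteq> b" using qi permutes_inv_eq[OF q] by (metis less_irrefl)
    then show ?thesis
      using 2 fib[OF le 2] Delta_mono[OF \<psi>, of i j] le qi by (auto simp: le_less)
  next
    case 3
    then have "a \<noteq> b" using qi permutes_inv_eq[OF q] by (metis less_irrefl)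
    show ?thesis
    proof (cases "\<psi> i = \<psi> j")
      case True
      then have "b < a \<longleftrightarrow> \<not> \<epsilon> (\<phi> a)"
        using fib[OF le(2) le(1) 3] qi fibeq by simp
      then show ?thesis using True 3 \<open>a \<noteq> b\<close> by auto
    next
      case False
      then show ?thesis using 3 Delta_mono[OF \<psi>, of j i] le by auto
    qed
  qed
  then show ?thesis using \<psi>eq fibeq by (simp add: cross_less_def i_def j_def)
qed

text \<open>The inverse of \<open>q\<close> is the rank function of \<open>cross_less\<close>, so
  \<open>q\<close> is determined; then \<open>\<gamma> (\<psi> j) = \<phi> (q j)\<close> determines
  \<open>\<psi>\<close>, as \<open>\<gamma>\<close> is injective.\<close>

lemma fibre_cross_unique:
  assumes \<gamma>: "\<gamma> permutes {..n}"
    and cr: "fibre_cross m n \<epsilon> \<gamma> \<phi> \<psi> q" and cr': "fibre_cross m n \<epsilon> \<gamma> \<phi> \<psi>' q'"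
  shows "\<psi> = \<psi>'" and "q = q'"
proof -
  have q: "q permutes {..m}" and q': "q' permutes {..m}"
    using cr cr' by (auto simp: fibre_cross_def)
  have "Hilbert_Choice.inv q b = Hilbert_Choice.inv q' b" for b
  proof (cases "b \<le> m")
    case True
    have "{a. a \<le> m \<and> Hilbert_Choice.inv q a < Hilbert_Choice.inv q b} =
        {a. a \<le> m \<and> Hilbert_Choice.inv q' a < Hilbert_Choice.inv q' b}"
      using fibre_cross_inv_less_iff[OF \<gamma> cr] fibre_cross_inv_less_iff[OF \<gamma> cr'] True by auto
    then show ?thesis
      using permutes_atMost_eq_card[OF permutes_inv[OF q] True]
        permutes_atMost_eq_card[OF permutes_inv[OF q'] True] by simp
  next
    case False
    then show ?thesis
      using permutes_not_in[OF permutes_inv[OF q]] permutes_not_in[OF permutes_inv[OF q']] by simp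
  qed
  then have "Hilbert_Choice.inv q = Hilbert_Choice.inv q'" by auto
  then show qq: "q = q'" using permutes_inv_inv q q' by metis
  show "\<psi> = \<psi>'"
  proof (rule Delta_eqI)
    show "\<psi> \<in> Delta m n" "\<psi>' \<in> Delta m n"
      using cr cr' by (auto simp: fibre_cross_def)
    fix j assume "j \<le> m"
    then have "\<gamma> (\<psi> j) = \<gamma> (\<psi>' j)"
      using cr cr' qq by (auto simp: fibre_cross_def)
    then show "\<psi> j = \<psi>' j" using permutes_inj[OF \<gamma>] by (auto dest: injD)
  qed
qed

text \<open>\<open>cross_less\<close> is a strict total order on \<open>{..m}\<close>. Its rank
  function is a permutation, and the inverse of that permutation lists the elements in the required
  order.\<close>

lemma fibre_cross_exists:
  assumes \<gamma>: "\<gamma> permutes {..n}" and \<phi>: "\<phi> \<in> Delta m n"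
  shows "\<exists>\<psi> q. fibre_cross m n \<epsilon> \<gamma> \<phi> \<psi> q"
proof -
  let ?R = "cross_less \<epsilon> \<gamma> \<phi>"
  define r where "r b = (if b \<le> m then card {a. a \<le> m \<and> ?R a b} else b)" for b
  have irrefl: "\<not> ?R a a" for a by (simp add: cross_less_def)
  have trans: "?R a b \<Longrightarrow> ?R b c \<Longrightarrow> ?R a c" for a b c
    by (auto simp: cross_less_def split: if_splits)
  have total: "?R a b \<or> ?R b a" if "a \<noteq> b" for a b
  proof (cases "\<phi> a = \<phi> b")
    case True
    with that show ?thesis by (auto simp: cross_less_def)
  next
    case False
    then have "Hilbert_Choice.inv \<gamma> (\<phi> a) \<noteq> Hilbert_Choice.inv \<gamma> (\<phi> b)"
      using permutes_inj[OF permutes_inv[OF \<gamma>]] by (auto dest: injD)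
    then show ?thesis by (auto simp: cross_less_def)
  qed
  have less: "r a < r b" if "a \<le> m" "b \<le> m" "?R a b" for a b
  proof -
    have "{c. c \<le> m \<and> ?R c a} \<subset> {c. c \<le> m \<and> ?R c b}"
      using that trans irrefl by blast
    then show ?thesis using that by (simp add: r_def psubset_card_mono)
  qed
  have less_iff: "r a < r b \<longleftrightarrow> ?R a b" if "a \<le> m" "b \<le> m" for a b
    using that less[of a b] less[of b a] total[of a b] by (cases "a = b") (auto simp: irrefl)
  have inj: "inj_on r {..m}"
    using less total by (intro inj_onI) (metis atMost_iff nat_less_le)
  have "r b \<le> m" if "b \<le> m" for b
  proof -
    have "{a. a \<le> m \<and> ?R a b} \<subset> {..m}" using that irrefl by blast
    then have "card {a. a \<le> m \<and> ?R a b} < card {..m}" by (intro psubset_card_mono) auto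
    then show ?thesis using that by (simp add: r_def)
  qed
  then have "r ` {..m} = {..m}"
    by (intro card_subset_eq) (auto simp: card_image[OF inj])
  then have r: "r permutes {..m}"
    using inj by (intro bij_imp_permutes) (auto simp: bij_betw_def r_def)
  define q where "q = Hilbert_Choice.inv r"
  \<comment> \<open>Forced by the commutation condition; it is monotone because \<open>q\<close>
    lists \<open>{..m}\<close> in increasing \<open>cross_less\<close> order.\<close>
  define \<psi> where "\<psi> = (\<lambda>j\<in>{..m}. Hilbert_Choice.inv \<gamma> (\<phi> (q j)))"
  have q: "q permutes {..m}" using permutes_inv[OF r] by (simp add: q_def)
  have rq: "r (q j) = j" for j using permutes_inverses[OF r] by (simp add: q_def)
  have qle: "j \<le> m \<Longrightarrow> q j \<le> m" for j by (rule permutes_atMost_le[OF q])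
  have R: "i < j \<longleftrightarrow> ?R (q i) (q j)" if "i \<le> m" "j \<le> m" for i j
    using less_iff[OF qle[OF that(1)] qle[OF that(2)]] rq by simp
  have "\<psi> i \<le> \<psi> j" if "i \<le> j" "j \<le> m" for i j
  proof (cases "i = j")
    case False
    with R[of i j] that have "?R (q i) (q j)" by simp
    then show ?thesis using that by (auto simp: \<psi>_def cross_less_def)
  qed simp
  then have \<psi>: "\<psi> \<in> Delta m n"
    using permutes_atMost_le[OF permutes_inv[OF \<gamma>]] Delta_le[OF \<phi>] qle
    by (auto simp: Delta_iff \<psi>_def)
  have "fibre_cross m n \<epsilon> \<gamma> \<phi> \<psi> q"
    unfolding fibre_cross_def
  proof (intro conjI allI impI)
    fix j assume "j \<le> m"
    then show "\<gamma> (\<psi> j) = \<phi> (q j)" using permutes_inverses[OF \<gamma>] by (simp add: \<psi>_def)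
  next
    fix i j assume ij: "i \<le> m" "j \<le> m" "i < j" "\<psi> i = \<psi> j"
    then have "Hilbert_Choice.inv \<gamma> (\<phi> (q i)) = Hilbert_Choice.inv \<gamma> (\<phi> (q j))"
      by (simp add: \<psi>_def)
    with R[OF ij(1,2)] ij(3)
    show "(q i < q j) = (\<not> \<epsilon> (\<phi> (q i)))" by (auto simp: cross_less_def)
  qed (use \<psi> q in auto)
  then show ?thesis by blast
qed

text \<open>Only parities at values of \<open>\<phi>\<close> are ever read. This allows passing
  between restricted label functions, which are \<open>undefined\<close> beyond \<open>n\<close>,
  and unrestricted expressions.\<close>

lemma fibre_cross_cong:
  assumes "\<phi> \<in> Delta m n" and "\<And>k. k \<le> n \<Longrightarrow> \<epsilon> k \<longleftrightarrow> \<epsilon>' k" and "fibre_cross m n \<epsilon> \<gamma> \<phi> \<psi> q"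
  shows "fibre_cross m n \<epsilon>' \<gamma> \<phi> \<psi> q"
proof -
  have "\<epsilon> (\<phi> (q i)) \<longleftrightarrow> \<epsilon>' (\<phi> (q i))" if "i \<le> m" for i
    using assms permutes_atMost_le[of q m i] Delta_le[OF assms(1)] that
    by (auto simp: fibre_cross_def)
  then show ?thesis using assms(3) by (auto simp: fibre_cross_def)
qed

lemma fibre_cross_id_perm: "\<phi> \<in> Delta m n \<Longrightarrow> fibre_cross m n (\<lambda>_. False) id \<phi> \<phi> id"
  by (simp add: fibre_cross_def permutes_id)

text \<open>All fibres are singletons, so any parity is allowed.\<close>

lemma fibre_cross_id_map:
  "\<gamma> permutes {..n} \<Longrightarrow>
    fibre_cross n n \<epsilon> \<gamma> (restrict id {..n}) (restrict id {..n}) \<gamma>"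
  by (simp add: fibre_cross_def id_in_Delta permutes_atMost_le)

text \<open>Within a fibre of \<open>\<psi>'\<close> the order is possibly flipped by
  \<open>q'\<close> and then by \<open>q\<close>, whence the exclusive or. The second flip set is
  indexed through \<open>\<psi>\<close>, and
  \<open>\<gamma> \<circ> \<psi> = \<phi> \<circ> q\<close> on \<open>{..m}\<close> turns this into
  the shift by the inverse of \<open>\<gamma>\<close> that the wreath product applies to its second
  label.\<close>

lemma fibre_cross_mult:
  assumes \<gamma>: "\<gamma> permutes {..n}" and \<phi>: "\<phi> \<in> Delta m n"
    and cr: "fibre_cross m n \<epsilon> \<gamma> \<phi> \<psi> q" and cr': "fibre_cross m n \<epsilon>' \<gamma>' \<psi> \<psi>' q'"
  shows "fibre_cross m n (\<lambda>k. \<epsilon> k \<noteq> \<epsilon>' (Hilbert_Choice.inv \<gamma> k)) (\<gamma> \<circ> \<gamma>') \<phi> \<psi>' (q \<circ> q')"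
proof -
  have q: "q permutes {..m}" and q': "q' permutes {..m}" and \<psi>': "\<psi>' \<in> Delta m n"
    and comm: "\<And>j. j \<le> m \<Longrightarrow> \<gamma> (\<psi> j) = \<phi> (q j)"
    and comm': "\<And>j. j \<le> m \<Longrightarrow> \<gamma>' (\<psi>' j) = \<psi> (q' j)"
    and fib: "\<And>i j. i \<le> m \<Longrightarrow> j \<le> m \<Longrightarrow> i < j \<Longrightarrow> \<psi> i = \<psi> j \<Longrightarrow> q i < q j \<longleftrightarrow> \<not> \<epsilon> (\<phi> (q i))"
    and fib': "\<And>i j. i \<le> m \<Longrightarrow> j \<le> m \<Longrightarrow> i < j \<Longrightarrow> \<psi>' i = \<psi>' j \<Longrightarrow>
      q' i < q' j \<longleftrightarrow> \<not> \<epsilon>' (\<psi> (q' i))"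
    using cr cr' by (auto simp: fibre_cross_def)
  have le: "j \<le> m \<Longrightarrow> q' j \<le> m" for j by (rule permutes_atMost_le[OF q'])
  have "q (q' i) < q (q' j) \<longleftrightarrow>
      \<not> (\<epsilon> (\<phi> (q (q' i))) \<noteq> \<epsilon>' (Hilbert_Choice.inv \<gamma> (\<phi> (q (q' i)))))"
    if ij: "i \<le> m" "j \<le> m" "i < j" "\<psi>' i = \<psi>' j" for i j
  proof -
    have \<psi>eq: "\<psi> (q' i) = \<psi> (q' j)" using comm' ij by metis
    have \<phi>eq: "\<phi> (q (q' i)) = \<phi> (q (q' j))" using comm le ij \<psi>eq by metis
    have inv: "Hilbert_Choice.inv \<gamma> (\<phi> (q (q' i))) = \<psi> (q' i)"
      using comm[OF le[OF ij(1)]] permutes_inv_eq[OF \<gamma>] by metis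
    have ne: "q (q' i) \<noteq> q (q' j)" "q' i \<noteq> q' j"
      using ij permutes_inj[OF q] permutes_inj[OF q'] by (metis injD less_irrefl)+
    show ?thesis
    proof (cases "q' i < q' j")
      case True
      then show ?thesis
        using fib[OF le[OF ij(1)] le[OF ij(2)] True \<psi>eq] fib'[OF ij] inv by auto
    next
      case False
      then have "q' j < q' i" using ne by simp
      from fib[OF le[OF ij(2)] le[OF ij(1)] this \<psi>eq[symmetric]]
      show ?thesis using False fib'[OF ij] inv \<phi>eq ne by auto
    qed
  qed
  then show ?thesis
    using \<psi>' permutes_compose[OF q' q] comm comm' le by (auto simp: fibre_cross_def)
qed

text \<open>Two positions in one fibre of the composite either share a fibre of
  \<open>\<omega>\<close>, where the inner crossing decides their order, or are separated by
  \<open>\<omega>\<close>. In the latter case the outer crossing decides, and monotonicity of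
  \<open>\<chi>\<close> carries the answer back to \<open>r\<close>.\<close>

lemma fibre_cross_compose:
  assumes \<phi>: "\<phi> \<in> Delta m n" and \<chi>: "\<chi> \<in> Delta l m"
    and cr: "fibre_cross m n \<epsilon> \<gamma> \<phi> \<psi> q" and cr': "fibre_cross l m (\<lambda>j. \<epsilon> (\<phi> j)) q \<chi> \<omega> r"
  shows "fibre_cross l n \<epsilon> \<gamma> (compose {..l} \<phi> \<chi>) (compose {..l} \<psi> \<omega>) r"
proof -
  have \<psi>: "\<psi> \<in> Delta m n" and \<omega>: "\<omega> \<in> Delta l m"
    and q: "q permutes {..m}" and r: "r permutes {..l}"
    and comm: "\<And>j. j \<le> m \<Longrightarrow> \<gamma> (\<psi> j) = \<phi> (q j)"
    and comm': "\<And>j. j \<le> l \<Longrightarrow> q (\<omega> j) = \<chi> (r j)"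
    and fib: "\<And>i j. i \<le> m \<Longrightarrow> j \<le> m \<Longrightarrow> i < j \<Longrightarrow> \<psi> i = \<psi> j \<Longrightarrow> q i < q j \<longleftrightarrow> \<not> \<epsilon> (\<phi> (q i))"
    and fib': "\<And>i j. i \<le> l \<Longrightarrow> j \<le> l \<Longrightarrow> i < j \<Longrightarrow> \<omega> i = \<omega> j \<Longrightarrow>
      r i < r j \<longleftrightarrow> \<not> \<epsilon> (\<phi> (\<chi> (r i)))"
    using cr cr' by (auto simp: fibre_cross_def)
  have rle: "j \<le> l \<Longrightarrow> r j \<le> l" for j by (rule permutes_atMost_le[OF r])
  have "r i < r j \<longleftrightarrow> \<not> \<epsilon> (\<phi> (\<chi> (r i)))"
    if ij: "i \<le> l" "j \<le> l" "i < j" "\<psi> (\<omega> i) = \<psi> (\<omega> j)" for i j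
  proof (cases "\<omega> i = \<omega> j")
    case True
    then show ?thesis using fib' ij by simp
  next
    case False
    then have lt: "\<omega> i < \<omega> j" using Delta_mono[OF \<omega>, of i j] ij by simp
    have *: "\<chi> (r i) < \<chi> (r j) \<longleftrightarrow> \<not> \<epsilon> (\<phi> (\<chi> (r i)))"
      using fib[OF Delta_le[OF \<omega> ij(1)] Delta_le[OF \<omega> ij(2)] lt ij(4)]
        comm'[OF ij(1)] comm'[OF ij(2)] by simp
    have "\<chi> (r i) \<noteq> \<chi> (r j)"
      using False comm'[OF ij(1)] comm'[OF ij(2)] permutes_inj[OF q] by (metis injD)
    moreover have "r i \<le> r j \<Longrightarrow> \<chi> (r i) \<le> \<chi> (r j)" "r j \<le> r i \<Longrightarrow> \<chi> (r j) \<le> \<chi> (r i)"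
      using Delta_mono[OF \<chi>] rle ij(1,2) by blast+
    ultimately have "r i < r j \<longleftrightarrow> \<chi> (r i) < \<chi> (r j)"
      by linarith
    then show ?thesis using * by simp
  qed
  then show ?thesis
    using compose_in_Delta[OF \<omega> \<psi>] r comm comm' rle Delta_le[OF \<omega>]
    by (auto simp: fibre_cross_def compose_apply)
qed

section \<open>The explicit formulas for symmetric groups and block reversals as crossings\<close>

text \<open>Injectivity of \<open>p\<close> upgrades weak to strict monotonicity on fibres. The
  left-hand side is verbatim the condition in \<open>sym_cross\<close>, so it can be rewritten under
  the description operator.\<close>

lemma sym_cross_iff_fibre_cross:
  "(\<psi> \<in> Delta m n \<and> p permutes {..m} \<and> (\<forall>j\<le>m. \<gamma> (\<psi> j) = \<phi> (p j)) \<and>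
    (\<forall>i\<le>n. mono_on {j \<in> {..m}. \<psi> j = i} p)) \<longleftrightarrow> fibre_cross m n (\<lambda>_. False) \<gamma> \<phi> \<psi> p"
  (is "?L \<longleftrightarrow> ?R")
proof
  assume L: ?L
  have "p i < p j" if "i \<le> m" "j \<le> m" "i < j" "\<psi> i = \<psi> j" for i j
  proof -
    have "mono_on {k \<in> {..m}. \<psi> k = \<psi> j} p" using L Delta_le[of \<psi> m n j] that by blast
    then have "p i \<le> p j" using that by (auto simp: mono_on_def)
    moreover have "p i \<noteq> p j" using L that permutes_inj[of p] by (metis injD less_irrefl)
    ultimately show ?thesis by simp
  qed
  with L show ?R by (simp add: fibre_cross_def)
next
  assume R: ?R
  then have "mono_on {j \<in> {..m}. \<psi> j = i} p" for i
    by (auto simp: mono_on_def fibre_cross_def le_less)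
  with R show ?L by (simp add: fibre_cross_def)
qed

lemma fibre_cross_sym_cross:
  assumes \<gamma>: "\<gamma> permutes {..n}" and \<phi>: "\<phi> \<in> Delta m n"
  shows "fibre_cross m n (\<lambda>_. False) \<gamma> \<phi> (fst (sym_cross m n \<gamma> \<phi>)) (snd (sym_cross m n \<gamma> \<phi>))"
proof -
  have "\<exists>!z. case z of (\<psi>, p) \<Rightarrow> fibre_cross m n (\<lambda>_. False) \<gamma> \<phi> \<psi> p"
    using fibre_cross_exists[OF assms, of "\<lambda>_. False"] fibre_cross_unique[OF \<gamma>] by fast
  from theI'[OF this]
  have "case sym_cross m n \<gamma> \<phi> of (\<psi>, p) \<Rightarrow> fibre_cross m n (\<lambda>_. False) \<gamma> \<phi> \<psi> p"
    by (simp only: sym_cross_def sym_cross_iff_fibre_cross)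
  then show ?thesis by (simp only: case_prod_beta)
qed

text \<open>Monotonicity squeezes \<open>\<phi>\<close> between its equal values at the minimum and
  the maximum of the block, so the reflection stays in the block. There the truncated subtraction is
  exact, which makes the reflection an involution.\<close>

lemma block_reversal_fibre:
  assumes "j \<le> m" and "\<phi> \<in> Delta m n"
  shows "block_reversal par m \<phi> g j \<le> m" and "\<phi> (block_reversal par m \<phi> g j) = \<phi> j"
    and "block_reversal par m \<phi> g (block_reversal par m \<phi> g j) = j"
proof -
  define A where "A = {k \<in> {..m}. \<phi> k = \<phi> j}"
  let ?B = "block_reversal par m \<phi> g"
  have A: "finite A" "j \<in> A" using assms by (auto simp: A_def)
  have B_eq: "?B i = (if par (g (\<phi> j)) = -1 then Min A + Max A - i else i)" if "i \<in> A" for i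
    using that by (simp add: block_reversal_def A_def)
  have Min: "Min A \<le> m" "\<phi> (Min A) = \<phi> j" and Max: "Max A \<le> m" "\<phi> (Max A) = \<phi> j"
    using A Min_in[OF A(1)] Max_in[OF A(1)] unfolding A_def by blast+
  have bounds: "Min A \<le> j" "j \<le> Max A"
    using A by (auto intro: Min_le Max_ge)
  then have B: "Min A \<le> ?B j" "?B j \<le> Max A"
    using B_eq[OF A(2)] by auto
  show le: "?B j \<le> m" using B(2) Max(1) by simp
  show eq: "\<phi> (?B j) = \<phi> j"
    using Delta_mono[OF assms(2) B(1) le] Delta_mono[OF assms(2) B(2) Max(1)] Min(2) Max(2)
    by simp
  have "?B j \<in> A" using le eq by (simp add: A_def)
  then show "?B (?B j) = j" using B_eq[of "?B j"] B_eq[OF A(2)] bounds by simp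
qed

lemma block_reversal_permutes:
  assumes "\<phi> \<in> Delta m n"
  shows "block_reversal par m \<phi> g permutes {..m}"
proof (rule bij_imp_permutes)
  show "bij_betw (block_reversal par m \<phi> g) {..m} {..m}"
    by (rule bij_betw_byWitness[where f' = "block_reversal par m \<phi> g"])
      (use block_reversal_fibre[OF _ assms, of _ par g] in auto)
qed (simp add: block_reversal_def)

text \<open>Reversal moves points only inside fibres of \<open>\<phi>\<close>, so the commutation
  with the same \<open>\<psi>\<close> survives, while the order within the odd fibres is flipped.
  The resulting permutation is the one occurring in \<open>twisted_pull\<close>.\<close>

lemma fibre_cross_block_reversal:
  assumes \<phi>: "\<phi> \<in> Delta m n" and cr: "fibre_cross m n (\<lambda>_. False) \<gamma> \<phi> \<psi> p"
  shows "fibre_cross m n (\<lambda>k. par (g k) = -1) \<gamma> \<phi> \<psi> (block_reversal par m \<phi> g \<circ> p)"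
proof -
  let ?B = "block_reversal par m \<phi> g"
  have p: "p permutes {..m}" using cr by (simp add: fibre_cross_def)
  note ple = permutes_atMost_le[OF p]
  have "?B (p i) < ?B (p j) \<longleftrightarrow> \<not> par (g (\<phi> (?B (p i)))) = -1"
    if ij: "i \<le> m" "j \<le> m" "i < j" "\<psi> i = \<psi> j" for i j
  proof -
    have lt: "p i < p j" and eq: "\<phi> (p i) = \<phi> (p j)"
      using cr ij unfolding fibre_cross_def by metis+
    define A where "A = {k \<in> {..m}. \<phi> k = \<phi> (p j)}"
    have A: "p i \<in> A" "p j \<in> A" using ple ij eq by (auto simp: A_def)
    have "?B k = (if par (g (\<phi> (p j))) = -1 then Min A + Max A - k else k)" if "k \<in> A" for k
      using that by (simp add: block_reversal_def A_def)
    moreover have "p j \<le> Max A" using A(2) by (intro Max_ge) (auto simp: A_def)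
    ultimately have "?B (p i) < ?B (p j) \<longleftrightarrow> \<not> par (g (\<phi> (p i))) = -1"
      using lt eq A by auto
    then show ?thesis using block_reversal_fibre(2)[OF ple[OF ij(1)] \<phi>, of par g] by simp
  qed
  moreover have "\<gamma> (\<psi> j) = \<phi> (?B (p j))" if "j \<le> m" for j
    using cr that block_reversal_fibre(2)[OF ple[OF that] \<phi>, of par g] by (simp add: fibre_cross_def)
  ultimately show ?thesis
    using cr permutes_compose[OF p block_reversal_permutes[OF \<phi>]] by (simp add: fibre_cross_def)
qed

section \<open>Calculus in a crossed simplicial group\<close>

context crossed_simplicial_group
begin

lemma incl_in: "\<phi> \<in> Delta m n \<Longrightarrow> incl X m n \<phi> \<in> arrows X m n"
  using incl.map_in by simp

lemma incl_id: "incl X n n (restrict id {..n}) = idn X n"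
  using incl.map_idn[of n] by simp

lemma incl_compose:
  "\<phi> \<in> Delta m n \<Longrightarrow> \<psi> \<in> Delta n k \<Longrightarrow>
    incl X m k (compose {..m} \<psi> \<phi>) = cmp X m n k (incl X n k \<psi>) (incl X m n \<phi>)"
  using incl.map_cmp by simp

lemma grp_one_closed [simp]: "\<one>\<^bsub>grp X n\<^esub> \<in> carrier (grp X n)"
  by (rule monoid.one_closed[OF group.is_monoid[OF group_grp]])

lemma grp_m_closed [simp]:
  "g \<in> carrier (grp X n) \<Longrightarrow> h \<in> carrier (grp X n) \<Longrightarrow> g \<otimes>\<^bsub>grp X n\<^esub> h \<in> carrier (grp X n)"
  by (rule monoid.m_closed[OF group.is_monoid[OF group_grp]])

lemma aut_in_Aut: "g \<in> carrier (grp X n) \<Longrightarrow> aut X n g \<in> carrier (Aut_group X n)"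
  using aut_iso[of n] by (auto simp: iso_def hom_def opposite_group_def)

lemma aut_in: "g \<in> carrier (grp X n) \<Longrightarrow> aut X n g \<in> arrows X n n"
  using aut_in_Aut by (simp add: Aut_group_def)

lemma aut_mult:
  "g \<in> carrier (grp X n) \<Longrightarrow> h \<in> carrier (grp X n) \<Longrightarrow>
    aut X n (g \<otimes>\<^bsub>grp X n\<^esub> h) = cmp X n n n (aut X n h) (aut X n g)"
  using aut_iso[of n] by (auto simp: iso_def hom_def opposite_group_def Aut_group_def)

text \<open>\<open>hom\<close> records only multiplicativity. The image of the unit is therefore an
  idempotent, and it is cancelled by the left inverse supplied by membership in
  \<open>Aut_group\<close>.\<close>

lemma aut_one: "aut X n \<one>\<^bsub>grp X n\<^esub> = idn X n"
proof -
  let ?e = "aut X n \<one>\<^bsub>grp X n\<^esub>"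
  have e: "?e \<in> arrows X n n" by (rule aut_in) simp
  obtain v where v: "v \<in> arrows X n n" "cmp X n n n v ?e = idn X n"
    using aut_in_Aut[of "\<one>\<^bsub>grp X n\<^esub>" n] by (auto simp: Aut_group_def)
  have "cmp X n n n ?e ?e = ?e"
    using aut_mult[of "\<one>\<^bsub>grp X n\<^esub>" n "\<one>\<^bsub>grp X n\<^esub>"] group.is_monoid[OF group_grp[of n]]
    by (simp add: monoid.l_one)
  then have "cmp X n n n (cmp X n n n v ?e) ?e = cmp X n n n v ?e"
    using cmp_assoc[OF e e v(1)] by simp
  then show ?thesis using v(2) cmp_idn_left[OF e] by simp
qed

lemma factorization_eq:
  assumes "\<phi> \<in> Delta m n" and "g \<in> carrier (grp X m)"
  shows "factorization X m n (cmp X m m n (incl X m n \<phi>) (aut X m g)) = (\<phi>, g)"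
proof -
  have "cmp X m m n (incl X m n \<phi>) (aut X m g) \<in> arrows X m n"
    using assms by (intro cmp_in aut_in incl_in)
  from unique_factorization[OF this] show ?thesis
    unfolding factorization_def by (rule the1_equality) (use assms in simp)
qed

lemma factorization_cases:
  assumes "u \<in> arrows X m n"
  obtains \<phi> g where "\<phi> \<in> Delta m n" "g \<in> carrier (grp X m)"
    "u = cmp X m m n (incl X m n \<phi>) (aut X m g)"
  using ex1_implies_ex[OF unique_factorization[OF assms]] by auto

text \<open>The means of computing both operations: rewrite the composite of \<phi> followed by g as
  an automorphism followed by a simplicial map, and read off the two parts.\<close>

lemma act_pull_unique:
  assumes "\<psi> \<in> Delta m n" and "h \<in> carrier (grp X m)"
    and "cmp X m n n (aut X n g) (incl X m n \<phi>) = cmp X m m n (incl X m n \<psi>) (aut X m h)"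
  shows "act X m n g \<phi> = \<psi>" and "pull X m n \<phi> g = h"
  using factorization_eq[OF assms(1,2)] assms(3) by (simp_all add: act_def pull_def)

context
  fixes m n \<phi> g
  assumes \<phi>: "\<phi> \<in> Delta m n" and g: "g \<in> carrier (grp X n)"
begin

lemma act_pull_properties:
  "act X m n g \<phi> \<in> Delta m n \<and> pull X m n \<phi> g \<in> carrier (grp X m) \<and>
    cmp X m n n (aut X n g) (incl X m n \<phi>) =
      cmp X m m n (incl X m n (act X m n g \<phi>)) (aut X m (pull X m n \<phi> g))"
proof -
  have "cmp X m n n (aut X n g) (incl X m n \<phi>) \<in> arrows X m n"
    using \<phi> g by (intro cmp_in aut_in incl_in)
  then obtain \<psi> h where h: "\<psi> \<in> Delta m n" "h \<in> carrier (grp X m)"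
    "cmp X m n n (aut X n g) (incl X m n \<phi>) = cmp X m m n (incl X m n \<psi>) (aut X m h)"
    by (rule factorization_cases)
  then show ?thesis using act_pull_unique[OF h] by simp
qed

lemma act_in: "act X m n g \<phi> \<in> Delta m n"
  and pull_in: "pull X m n \<phi> g \<in> carrier (grp X m)"
  and aut_incl: "cmp X m n n (aut X n g) (incl X m n \<phi>) =
      cmp X m m n (incl X m n (act X m n g \<phi>)) (aut X m (pull X m n \<phi> g))"
  using act_pull_properties by auto

end

text \<open>Moving \<open>h\<close> past \<open>\<phi>\<close> brings all automorphisms to the
  right. Composition is thus encoded by \<open>act\<close>, \<open>pull\<close> and the group
  products, so a functor has only these to respect.\<close>

lemma cmp_normal_form:
  assumes \<phi>: "\<phi> \<in> Delta m n" and \<psi>: "\<psi> \<in> Delta n k"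
    and g: "g \<in> carrier (grp X m)" and h: "h \<in> carrier (grp X n)"
  shows "cmp X m n k (cmp X n n k (incl X n k \<psi>) (aut X n h))
      (cmp X m m n (incl X m n \<phi>) (aut X m g)) =
    cmp X m m k (incl X m k (compose {..m} \<psi> (act X m n h \<phi>)))
      (aut X m (g \<otimes>\<^bsub>grp X m\<^esub> pull X m n \<phi> h))"
proof -
  note in\<phi> = incl_in[OF \<phi>] and in\<psi> = incl_in[OF \<psi>] and ag = aut_in[OF g] and ah = aut_in[OF h]
  note in\<phi>' = incl_in[OF act_in[OF \<phi> h]] and ap = aut_in[OF pull_in[OF \<phi> h]]
  have "cmp X m n k (cmp X n n k (incl X n k \<psi>) (aut X n h)) (cmp X m m n (incl X m n \<phi>) (aut X m g))
    = cmp X m n k (incl X n k \<psi>) (cmp X m m n (cmp X m n n (aut X n h) (incl X m n \<phi>)) (aut X m g))"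
    using cmp_assoc[OF cmp_in[OF ag in\<phi>] ah in\<psi>] cmp_assoc[OF ag in\<phi> ah] by simp
  also have "\<dots> = cmp X m n k (incl X n k \<psi>)
      (cmp X m m n (incl X m n (act X m n h \<phi>)) (cmp X m m m (aut X m (pull X m n \<phi> h)) (aut X m g)))"
    using aut_incl[OF \<phi> h] cmp_assoc[OF ag ap in\<phi>'] by simp
  also have "\<dots> = cmp X m m k (cmp X m n k (incl X n k \<psi>) (incl X m n (act X m n h \<phi>)))
      (cmp X m m m (aut X m (pull X m n \<phi> h)) (aut X m g))"
    using cmp_assoc[OF cmp_in[OF ag ap] in\<phi>' in\<psi>] by simp
  also have "\<dots> = cmp X m m k (incl X m k (compose {..m} \<psi> (act X m n h \<phi>)))
      (aut X m (g \<otimes>\<^bsub>grp X m\<^esub> pull X m n \<phi> h))"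
    using incl_compose[OF act_in[OF \<phi> h] \<psi>] aut_mult[OF g pull_in[OF \<phi> h]] by simp
  finally show ?thesis .
qed

lemma act_one:
  assumes "\<phi> \<in> Delta m n"
  shows "act X m n \<one>\<^bsub>grp X n\<^esub> \<phi> = \<phi>"
  using act_pull_unique(1)[of \<phi> m n "\<one>\<^bsub>grp X m\<^esub>" "\<one>\<^bsub>grp X n\<^esub>" \<phi>] assms
  by (simp add: aut_one cmp_idn_left cmp_idn_right incl_in)

text \<open>As an arrow, the product of \<open>g\<close> and \<open>h\<close> is \<open>g\<close>
  followed by \<open>h\<close>. So \<open>g\<close> crosses \<open>\<phi>\<close> first, and
  \<open>h\<close> then meets the already moved map.\<close>

lemma
  assumes \<phi>: "\<phi> \<in> Delta m n" and g: "g \<in> carrier (grp X n)" and h: "h \<in> carrier (grp X n)"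
  shows act_mult: "act X m n (g \<otimes>\<^bsub>grp X n\<^esub> h) \<phi> = act X m n h (act X m n g \<phi>)"
    and pull_mult: "pull X m n \<phi> (g \<otimes>\<^bsub>grp X n\<^esub> h) =
      pull X m n \<phi> g \<otimes>\<^bsub>grp X m\<^esub> pull X m n (act X m n g \<phi>) h"
proof -
  let ?\<psi> = "act X m n g \<phi>" and ?p = "pull X m n \<phi> g"
  note \<psi> = act_in[OF \<phi> g] and p = pull_in[OF \<phi> g]
  note \<psi>' = act_in[OF \<psi> h] and p' = pull_in[OF \<psi> h]
  have "cmp X m n n (aut X n (g \<otimes>\<^bsub>grp X n\<^esub> h)) (incl X m n \<phi>) =
      cmp X m m n (cmp X m n n (aut X n h) (incl X m n ?\<psi>)) (aut X m ?p)"
    using cmp_assoc[OF incl_in[OF \<phi>] aut_in[OF g] aut_in[OF h]]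
      cmp_assoc[OF aut_in[OF p] incl_in[OF \<psi>] aut_in[OF h]] aut_mult[OF g h] aut_incl[OF \<phi> g]
    by simp
  also have "\<dots> = cmp X m m n (incl X m n (act X m n h ?\<psi>))
      (aut X m (?p \<otimes>\<^bsub>grp X m\<^esub> pull X m n ?\<psi> h))"
    using aut_incl[OF \<psi> h] aut_mult[OF p p']
      cmp_assoc[OF aut_in[OF p] aut_in[OF p'] incl_in[OF \<psi>']] by simp
  finally show "act X m n (g \<otimes>\<^bsub>grp X n\<^esub> h) \<phi> = act X m n h ?\<psi>"
    "pull X m n \<phi> (g \<otimes>\<^bsub>grp X n\<^esub> h) = ?p \<otimes>\<^bsub>grp X m\<^esub> pull X m n ?\<psi> h"
    by (rule act_pull_unique[OF \<psi>' grp_m_closed[OF p p']])+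
qed

text \<open>Moving \<open>g\<close> past a composite means moving it past \<open>\<phi>\<close> and
  then moving the resulting element of \<open>grp X m\<close> past \<open>\<chi>\<close>.\<close>

lemma
  assumes \<chi>: "\<chi> \<in> Delta l m" and \<phi>: "\<phi> \<in> Delta m n" and g: "g \<in> carrier (grp X n)"
  shows act_compose: "act X l n g (compose {..l} \<phi> \<chi>) =
      compose {..l} (act X m n g \<phi>) (act X l m (pull X m n \<phi> g) \<chi>)"
    and pull_compose: "pull X l n (compose {..l} \<phi> \<chi>) g = pull X l m \<chi> (pull X m n \<phi> g)"
proof -
  let ?\<psi> = "act X m n g \<phi>" and ?p = "pull X m n \<phi> g"
  note \<psi> = act_in[OF \<phi> g] and p = pull_in[OF \<phi> g]
  note \<omega> = act_in[OF \<chi> p] and r = pull_in[OF \<chi> p]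
  have "cmp X l n n (aut X n g) (incl X l n (compose {..l} \<phi> \<chi>)) =
      cmp X l m n (incl X m n ?\<psi>) (cmp X l m m (aut X m ?p) (incl X l m \<chi>))"
    using incl_compose[OF \<chi> \<phi>] aut_incl[OF \<phi> g]
      cmp_assoc[OF incl_in[OF \<chi>] incl_in[OF \<phi>] aut_in[OF g]]
      cmp_assoc[OF incl_in[OF \<chi>] aut_in[OF p] incl_in[OF \<psi>]] by simp
  also have "\<dots> = cmp X l l n (incl X l n (compose {..l} ?\<psi> (act X l m ?p \<chi>)))
      (aut X l (pull X l m \<chi> ?p))"
    using aut_incl[OF \<chi> p] cmp_assoc[OF aut_in[OF r] incl_in[OF \<omega>] incl_in[OF \<psi>]]
      incl_compose[OF \<omega> \<psi>] by simp
  finally show "act X l n g (compose {..l} \<phi> \<chi>) = compose {..l} ?\<psi> (act X l m ?p \<chi>)"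
    "pull X l n (compose {..l} \<phi> \<chi>) g = pull X l m \<chi> ?p"
    by (rule act_pull_unique[OF compose_in_Delta[OF \<omega> \<psi>] r])+
qed

end

section \<open>Functors from compatible families of homomorphisms\<close>

text \<open>By \<open>cmp_normal_form\<close>, on both sides a composite is expressed through
  products, \<open>act\<close> and \<open>pull\<close>, all preserved by \<open>f\<close>.
  Compatibility is stated for every simplicial map at once instead of for faces, degeneracies and
  \<theta> separately.\<close>

lemma csg_functor_induced:
  fixes X :: "('a, 'g) csg" and Y :: "('b, 'h) csg"
  assumes X: "crossed_simplicial_group X" and Y: "crossed_simplicial_group Y"
    and hom: "\<And>n. f n \<in> hom (grp X n) (grp Y n)"
    and act: "\<And>m n g \<phi>. g \<in> carrier (grp X n) \<Longrightarrow> \<phi> \<in> Delta m n \<Longrightarrow>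
      act Y m n (f n g) \<phi> = act X m n g \<phi>"
    and pull: "\<And>m n g \<phi>. g \<in> carrier (grp X n) \<Longrightarrow> \<phi> \<in> Delta m n \<Longrightarrow>
      pull Y m n \<phi> (f n g) = f m (pull X m n \<phi> g)"
  shows "csg_functor X Y f (induced_functor X Y f)"
proof -
  interpret X: crossed_simplicial_group X by (rule X)
  interpret Y: crossed_simplicial_group Y by (rule Y)
  let ?F = "induced_functor X Y f"
  have f_in: "g \<in> carrier (grp X n) \<Longrightarrow> f n g \<in> carrier (grp Y n)" for g n
    using hom by (auto simp: hom_def)
  have f_mult: "g \<in> carrier (grp X n) \<Longrightarrow> h \<in> carrier (grp X n) \<Longrightarrow>
      f n (g \<otimes>\<^bsub>grp X n\<^esub> h) = f n g \<otimes>\<^bsub>grp Y n\<^esub> f n h" for g h n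
    using hom by (auto simp: hom_def)
  have f_one: "f n \<one>\<^bsub>grp X n\<^esub> = \<one>\<^bsub>grp Y n\<^esub>" for n
    using hom_one[OF hom X.group_grp Y.group_grp] .
  have F_eq: "?F m n (cmp X m m n (incl X m n \<phi>) (aut X m g)) =
      cmp Y m m n (incl Y m n \<phi>) (aut Y m (f m g))"
    if "\<phi> \<in> Delta m n" "g \<in> carrier (grp X m)" for m n \<phi> g
    using X.factorization_eq[OF that] by (simp add: induced_functor_def)
  have F_incl: "?F m n (incl X m n \<phi>) = incl Y m n \<phi>" if "\<phi> \<in> Delta m n" for m n \<phi>
    using F_eq[OF that X.grp_one_closed] X.incl_in[OF that] Y.incl_in[OF that]
    by (simp add: X.aut_one Y.aut_one f_one X.cmp_idn_right Y.cmp_idn_right)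
  show ?thesis
  proof
    fix u m n assume "u \<in> arrows X m n"
    then show "?F m n u \<in> arrows Y m n"
      by (rule X.factorization_cases) (simp add: F_eq f_in Y.cmp_in[OF Y.aut_in Y.incl_in])
  next
    fix n show "?F n n (idn X n) = idn Y n"
      using F_incl[OF id_in_Delta] by (simp add: X.incl_id Y.incl_id)
  next
    fix u v m n k assume "u \<in> arrows X m n" and "v \<in> arrows X n k"
    then obtain \<phi> g \<psi> h where u: "\<phi> \<in> Delta m n" "g \<in> carrier (grp X m)"
        "u = cmp X m m n (incl X m n \<phi>) (aut X m g)"
      and v: "\<psi> \<in> Delta n k" "h \<in> carrier (grp X n)"
        "v = cmp X n n k (incl X n k \<psi>) (aut X n h)"
      by (meson X.factorization_cases)
    show "?F m k (cmp X m n k v u) = cmp Y m n k (?F n k v) (?F m n u)"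
      unfolding u(3) v(3)
      using u(1,2) v(1,2)
      by (simp add: X.cmp_normal_form Y.cmp_normal_form F_eq f_in f_mult act pull
          X.act_in X.pull_in compose_in_Delta[OF X.act_in])
  next
    fix g n assume g: "g \<in> carrier (grp X n)"
    show "?F n n (aut X n g) = aut Y n (f n g)"
      using F_eq[OF id_in_Delta g] X.aut_in[OF g] Y.aut_in[OF f_in[OF g]]
      by (simp add: X.incl_id Y.incl_id X.cmp_idn_left Y.cmp_idn_left)
  qed (use hom F_incl in auto)
qed

section \<open>Crossed products\<close>

text \<open>A matched pair of the simplex category with the groups \<open>K n\<close>; the crossed
  product built from it is a Zappa-Szep product.\<close>

locale crossed_operations =
  fixes K :: "nat \<Rightarrow> 'k monoid"
    and a :: "nat \<Rightarrow> nat \<Rightarrow> 'k \<Rightarrow> (nat \<Rightarrow> nat) \<Rightarrow> (nat \<Rightarrow> nat)"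
    and p :: "nat \<Rightarrow> nat \<Rightarrow> (nat \<Rightarrow> nat) \<Rightarrow> 'k \<Rightarrow> 'k"
  assumes group_K: "group (K n)"
    and a_in: "\<phi> \<in> Delta m n \<Longrightarrow> g \<in> carrier (K n) \<Longrightarrow> a m n g \<phi> \<in> Delta m n"
    and p_in: "\<phi> \<in> Delta m n \<Longrightarrow> g \<in> carrier (K n) \<Longrightarrow> p m n \<phi> g \<in> carrier (K m)"
    and a_one: "\<phi> \<in> Delta m n \<Longrightarrow> a m n \<one>\<^bsub>K n\<^esub> \<phi> = \<phi>"
    and p_one: "\<phi> \<in> Delta m n \<Longrightarrow> p m n \<phi> \<one>\<^bsub>K n\<^esub> = \<one>\<^bsub>K m\<^esub>"
    and a_id: "g \<in> carrier (K n) \<Longrightarrow> a n n g (restrict id {..n}) = restrict id {..n}"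
    and p_id: "g \<in> carrier (K n) \<Longrightarrow> p n n (restrict id {..n}) g = g"
    and a_mult: "\<phi> \<in> Delta m n \<Longrightarrow> g \<in> carrier (K n) \<Longrightarrow> h \<in> carrier (K n) \<Longrightarrow>
      a m n (g \<otimes>\<^bsub>K n\<^esub> h) \<phi> = a m n h (a m n g \<phi>)"
    and p_mult: "\<phi> \<in> Delta m n \<Longrightarrow> g \<in> carrier (K n) \<Longrightarrow> h \<in> carrier (K n) \<Longrightarrow>
      p m n \<phi> (g \<otimes>\<^bsub>K n\<^esub> h) = p m n \<phi> g \<otimes>\<^bsub>K m\<^esub> p m n (a m n g \<phi>) h"
    and a_compose: "\<chi> \<in> Delta l m \<Longrightarrow> \<phi> \<in> Delta m n \<Longrightarrow> g \<in> carrier (K n) \<Longrightarrow>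
      a l n g (compose {..l} \<phi> \<chi>) = compose {..l} (a m n g \<phi>) (a l m (p m n \<phi> g) \<chi>)"
    and p_compose: "\<chi> \<in> Delta l m \<Longrightarrow> \<phi> \<in> Delta m n \<Longrightarrow> g \<in> carrier (K n) \<Longrightarrow>
      p l n (compose {..l} \<phi> \<chi>) g = p l m \<chi> (p m n \<phi> g)"
begin

lemma K_closed [simp]:
  "\<one>\<^bsub>K n\<^esub> \<in> carrier (K n)"
  "g \<in> carrier (K n) \<Longrightarrow> h \<in> carrier (K n) \<Longrightarrow> g \<otimes>\<^bsub>K n\<^esub> h \<in> carrier (K n)"
  "g \<in> carrier (K n) \<Longrightarrow> \<one>\<^bsub>K n\<^esub> \<otimes>\<^bsub>K n\<^esub> g = g"
  "g \<in> carrier (K n) \<Longrightarrow> g \<otimes>\<^bsub>K n\<^esub> \<one>\<^bsub>K n\<^esub> = g"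
  using group.is_monoid[OF group_K[of n]]
  by (auto intro: monoid.one_closed monoid.m_closed simp: monoid.l_one monoid.r_one)

lemma K_assoc:
  "g \<in> carrier (K n) \<Longrightarrow> h \<in> carrier (K n) \<Longrightarrow> k \<in> carrier (K n) \<Longrightarrow>
    g \<otimes>\<^bsub>K n\<^esub> h \<otimes>\<^bsub>K n\<^esub> k = g \<otimes>\<^bsub>K n\<^esub> (h \<otimes>\<^bsub>K n\<^esub> k)"
  by (rule monoid.m_assoc[OF group.is_monoid[OF group_K]])

abbreviation "P \<equiv> crossed_product K a p"

lemma P_simps [simp]:
  "arrows P m n = Delta m n \<times> carrier (K m)"
  "cmp P m n k (\<psi>, h) (\<phi>, g) = (compose {..m} \<psi> (a m n h \<phi>), g \<otimes>\<^bsub>K m\<^esub> p m n \<phi> h)"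
  "idn P n = (restrict id {..n}, \<one>\<^bsub>K n\<^esub>)"
  "incl P m n \<phi> = (\<phi>, \<one>\<^bsub>K m\<^esub>)"
  "grp P = K"
  "aut P n g = (restrict id {..n}, g)"
  by (simp_all add: crossed_product_def)

text \<open>In the associativity law, \<open>a_mult\<close> and \<open>p_mult\<close> expand one
  bracketing and \<open>a_compose\<close> and \<open>p_compose\<close> the other, with the same
  result.\<close>

lemma nat_category_P: "nat_category P"
proof
  fix u v w m n k l
  show "idn P n \<in> arrows P n n" by (simp add: id_in_Delta)
  assume u: "u \<in> arrows P m n"
  show "cmp P m n n (idn P n) u = u" "cmp P m m n u (idn P m) = u"
    using u by (auto simp: id_compose_Delta compose_Delta_id a_one p_one a_id p_id)
  assume v: "v \<in> arrows P n k"
  show "cmp P m n k v u \<in> arrows P m k"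
    using u v by (auto simp: a_in p_in compose_in_Delta[OF a_in])
  assume w: "w \<in> arrows P k l"
  show "cmp P m n l (cmp P n k l w v) u = cmp P m k l w (cmp P m n k v u)"
    using u v w
    by (auto simp: a_in p_in a_mult p_mult a_compose[OF a_in] p_compose[OF a_in] K_assoc
        compose_Delta_assoc[OF a_in] compose_in_Delta)
qed

lemma csg_P: "crossed_simplicial_group P"
proof -
  interpret P: nat_category P by (rule nat_category_P)
  interpret simplex: nat_category simplex_category by (rule nat_category_simplex)
  interpret K: group "K n" for n by (rule group_K)
  have aut_cmp: "cmp P m m n (incl P m n \<phi>) (aut P m g) = (\<phi>, g)"
    if "\<phi> \<in> Delta m n" "g \<in> carrier (K m)" for m n \<phi> g
    using that by (simp add: a_one p_one p_id compose_Delta_id id_in_Delta)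
  \<comment> \<open>This gives surjectivity of \<open>aut P n\<close>: no invertible arrow has a
    nontrivial simplicial part.\<close>
  have Aut: "carrier (Aut_group P n) = {restrict id {..n}} \<times> carrier (K n)" for n
  proof (intro subset_antisym subsetI)
    fix u assume "u \<in> carrier (Aut_group P n)"
    then obtain \<phi> g \<psi> h where u: "u = (\<phi>, g)" "\<phi> \<in> Delta n n" "g \<in> carrier (K n)"
      and v: "\<psi> \<in> Delta n n" "h \<in> carrier (K n)"
        "cmp P n n n (\<phi>, g) (\<psi>, h) = (restrict id {..n}, \<one>\<^bsub>K n\<^esub>)"
      by (auto simp: Aut_group_def simp del: P_simps(2))
    \<comment> \<open>The simplicial part of a right inverse, moved across \<open>g\<close>, is a
      section of \<open>\<phi>\<close>.\<close>
    have "\<exists>j\<le>n. \<phi> j = i" if "i \<le> n" for i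
    proof -
      have "compose {..n} \<phi> (a n n g \<psi>) i = i" using v(3) that by simp
      then show ?thesis
        using that Delta_le[OF a_in[OF v(1) u(3)] that] by (auto simp: compose_apply)
    qed
    then have "\<phi> = restrict id {..n}" by (rule Delta_surj_eq_id[OF u(2)])
    then show "u \<in> {restrict id {..n}} \<times> carrier (K n)" using u by simp
  next
    fix u assume "u \<in> {restrict id {..n}} \<times> carrier (K n)"
    then obtain g where u: "u = (restrict id {..n}, g)" and g: "g \<in> carrier (K n)" by auto
    have "inv\<^bsub>K n\<^esub> g \<in> carrier (K n)" by (rule group.inv_closed[OF group_K g])
    then show "u \<in> carrier (Aut_group P n)"
      using g group.l_inv[OF group_K g] group.r_inv[OF group_K g]
      by (auto simp: u Aut_group_def id_in_Delta a_id p_id compose_Delta_id[OF id_in_Delta]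
          intro!: bexI[of _ "restrict id {..n}"] bexI[of _ "inv\<^bsub>K n\<^esub> g"])
  qed
  show ?thesis
  proof
    fix m n \<phi> assume "\<phi> \<in> arrows simplex_category m n"
    then show "incl P m n \<phi> \<in> arrows P m n" by simp
  next
    fix m n k \<phi> \<psi> assume "\<phi> \<in> arrows simplex_category m n" "\<psi> \<in> arrows simplex_category n k"
    then show "incl P m k (cmp simplex_category m n k \<psi> \<phi>) =
        cmp P m n k (incl P n k \<psi>) (incl P m n \<phi>)"
      by (simp add: a_one p_one)
  next
    fix n
    show "aut P n \<in> iso (opposite_group (grp P n)) (Aut_group P n)"
      using Aut[of n]
      by (auto simp: iso_def hom_def opposite_group_def bij_betw_def inj_on_def image_def)
        (auto simp: Aut_group_def a_id p_id compose_Delta_id[OF id_in_Delta] id_in_Delta)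
  next
    fix u m n assume "u \<in> arrows P m n"
    then obtain \<phi> g where u: "u = (\<phi>, g)" "\<phi> \<in> Delta m n" "g \<in> carrier (K m)" by auto
    show "\<exists>!(\<phi>, g). \<phi> \<in> Delta m n \<and> g \<in> carrier (grp P m) \<and>
        u = cmp P m m n (incl P m n \<phi>) (aut P m g)"
    proof (rule ex1I[of _ "(\<phi>, g)"])
      show "case (\<phi>, g) of (\<phi>, g) \<Rightarrow> \<phi> \<in> Delta m n \<and> g \<in> carrier (grp P m) \<and>
          u = cmp P m m n (incl P m n \<phi>) (aut P m g)"
        using u aut_cmp[OF u(2,3)] by (simp del: P_simps(2,4,6))
    next
      fix z assume "case z of (\<phi>, g) \<Rightarrow> \<phi> \<in> Delta m n \<and> g \<in> carrier (grp P m) \<and>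
          u = cmp P m m n (incl P m n \<phi>) (aut P m g)"
      then show "z = (\<phi>, g)" using u(1) aut_cmp by (cases z) (simp del: P_simps(2,4,6))
    qed
  qed (auto simp: inj_on_def K.m_assoc K.Units_eq)
qed

lemma
  assumes "\<phi> \<in> Delta m n" and "g \<in> carrier (K n)"
  shows act_P: "act P m n g \<phi> = a m n g \<phi>" and pull_P: "pull P m n \<phi> g = p m n \<phi> g"
proof -
  interpret P: crossed_simplicial_group P by (rule csg_P)
  have "cmp P m n n (aut P n g) (incl P m n \<phi>) =
      cmp P m m n (incl P m n (a m n g \<phi>)) (aut P m (p m n \<phi> g))"
    using assms by (simp add: a_in p_in p_one p_id a_one id_compose_Delta compose_Delta_id[OF a_in] id_in_Delta)
  then show "act P m n g \<phi> = a m n g \<phi>" "pull P m n \<phi> g = p m n \<phi> g"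
    using P.act_pull_unique[of "a m n g \<phi>" m n "p m n \<phi> g" g \<phi>] assms
    by (simp_all add: a_in p_in del: P_simps(2,4,6))
qed

end

section \<open>Wreath products and twisted symmetric crossed simplicial groups\<close>

lemma wreath_simps:
  "carrier (wreath G n) = ({..n} \<rightarrow>\<^sub>E carrier G) \<times> {\<gamma>. \<gamma> permutes {..n}}"
  "(g, \<gamma>) \<otimes>\<^bsub>wreath G n\<^esub> (h, \<delta>) =
    (\<lambda>i\<in>{..n}. g i \<otimes>\<^bsub>G\<^esub> h (Hilbert_Choice.inv \<gamma> i), \<gamma> \<circ> \<delta>)"
  "\<one>\<^bsub>wreath G n\<^esub> = (\<lambda>i\<in>{..n}. \<one>\<^bsub>G\<^esub>, id)"
  by (simp_all add: wreath_def)

lemma group_wreath: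
  assumes "group G"
  shows "group (wreath G n)"
proof -
  interpret G: group G by (rule assms)
  have inv_le: "\<gamma> permutes {..n} \<Longrightarrow> i \<le> n \<Longrightarrow> Hilbert_Choice.inv \<gamma> i \<le> n" for \<gamma> i
    by (rule permutes_atMost_le[OF permutes_inv])
  have mem: "g \<in> {..n} \<rightarrow>\<^sub>E carrier G \<Longrightarrow> i \<le> n \<Longrightarrow> g i \<in> carrier G" for g i
    by auto
  show ?thesis
  proof (rule groupI)
    fix x y assume "x \<in> carrier (wreath G n)" "y \<in> carrier (wreath G n)"
    then show "x \<otimes>\<^bsub>wreath G n\<^esub> y \<in> carrier (wreath G n)"
      by (auto simp: wreath_simps inv_le mem permutes_compose)
  next
    show "\<one>\<^bsub>wreath G n\<^esub> \<in> carrier (wreath G n)"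
      by (auto simp: wreath_simps permutes_id)
  next
    fix x y z
    assume "x \<in> carrier (wreath G n)" "y \<in> carrier (wreath G n)" "z \<in> carrier (wreath G n)"
    then show "x \<otimes>\<^bsub>wreath G n\<^esub> y \<otimes>\<^bsub>wreath G n\<^esub> z =
        x \<otimes>\<^bsub>wreath G n\<^esub> (y \<otimes>\<^bsub>wreath G n\<^esub> z)"
      by (auto simp: wreath_simps inv_le mem G.m_assoc o_inv_distrib permutes_bij o_assoc
          intro!: restrict_ext)
  next
    fix x assume "x \<in> carrier (wreath G n)"
    then show "\<one>\<^bsub>wreath G n\<^esub> \<otimes>\<^bsub>wreath G n\<^esub> x = x"
      by (auto simp: wreath_simps mem PiE_iff intro!: extensionalityI[of _ "{..n}"])
  next
    fix x assume "x \<in> carrier (wreath G n)"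
    then obtain g \<gamma> where x: "x = (g, \<gamma>)" "g \<in> {..n} \<rightarrow>\<^sub>E carrier G" "\<gamma> permutes {..n}"
      by (auto simp: wreath_simps)
    \<comment> \<open>In the product with \<open>x\<close> the label \<open>g\<close> is evaluated
      at the inverse of \<open>inv \<gamma>\<close>, that is at \<open>\<gamma> i\<close>, which
      dictates the index here.\<close>
    let ?y = "(\<lambda>i\<in>{..n}. inv\<^bsub>G\<^esub> g (\<gamma> i), Hilbert_Choice.inv \<gamma>)"
    have "?y \<otimes>\<^bsub>wreath G n\<^esub> x = \<one>\<^bsub>wreath G n\<^esub>"
      using x by (auto simp: wreath_simps permutes_inv_inv permutes_inv_o mem permutes_atMost_le
          intro!: restrict_ext)
    moreover have "?y \<in> carrier (wreath G n)"
      using x by (auto simp: wreath_simps mem permutes_atMost_le permutes_inv)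
    ultimately show "\<exists>y\<in>carrier (wreath G n). y \<otimes>\<^bsub>wreath G n\<^esub> x = \<one>\<^bsub>wreath G n\<^esub>" by blast
  qed
qed

text \<open>The defining formulas produce one crossing with the parities of the labels, so by
  uniqueness any other crossing with these parities has the same values. From here on neither
  \<open>sym_cross\<close> nor \<open>block_reversal\<close> has to be computed.\<close>

lemma twisted_eq_of_fibre_cross:
  assumes "group G" and g: "g \<in> {..n} \<rightarrow>\<^sub>E carrier G" and \<gamma>: "\<gamma> permutes {..n}"
    and \<phi>: "\<phi> \<in> Delta m n" and cr: "fibre_cross m n (\<lambda>k. par (g k) = -1) \<gamma> \<phi> \<psi> q"
  shows "twisted_act m n (g, \<gamma>) \<phi> = \<psi>"
    and "twisted_pull G par m n \<phi> (g, \<gamma>) = (\<lambda>j\<in>{..m}. g (\<phi> j), q)"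
proof -
  interpret G: group G by (rule assms(1))
  let ?B = "block_reversal par m \<phi> g"
  have cr': "fibre_cross m n (\<lambda>k. par (g k) = -1) \<gamma> \<phi>
      (fst (sym_cross m n \<gamma> \<phi>)) (?B \<circ> snd (sym_cross m n \<gamma> \<phi>))"
    by (rule fibre_cross_block_reversal[OF \<phi> fibre_cross_sym_cross[OF \<gamma> \<phi>]])
  show "twisted_act m n (g, \<gamma>) \<phi> = \<psi>"
    using fibre_cross_unique(1)[OF \<gamma> cr' cr] by (simp add: twisted_act_def)
  \<comment> \<open>The shifted index must stay in \<open>{..m}\<close>, where the second factor has
    the label one and not \<open>undefined\<close>.\<close>
  have "g (\<phi> j) \<otimes>\<^bsub>G\<^esub> (\<lambda>j\<in>{..m}. \<one>\<^bsub>G\<^esub>) (Hilbert_Choice.inv ?B j) = g (\<phi> j)" if "j \<le> m" for j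
    using permutes_atMost_le[OF permutes_inv[OF block_reversal_permutes[OF \<phi>, of par g]] that]
      PiE_mem[OF g, of "\<phi> j"] Delta_le[OF \<phi> that] by simp
  then show "twisted_pull G par m n \<phi> (g, \<gamma>) = (\<lambda>j\<in>{..m}. g (\<phi> j), q)"
    using fibre_cross_unique(2)[OF \<gamma> cr' cr]
    by (auto simp: twisted_pull_def wreath_simps intro!: restrict_ext)
qed

lemma twisted_cases:
  assumes G: "group G" and x: "x \<in> carrier (wreath G n)" and \<phi>: "\<phi> \<in> Delta m n"
  obtains g \<gamma> \<psi> q where "x = (g, \<gamma>)" "g \<in> {..n} \<rightarrow>\<^sub>E carrier G" "\<gamma> permutes {..n}"
    "fibre_cross m n (\<lambda>k. par (g k) = -1) \<gamma> \<phi> \<psi> q" "\<psi> \<in> Delta m n" "q permutes {..m}"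
    "(\<lambda>j\<in>{..m}. g (\<phi> j)) \<in> {..m} \<rightarrow>\<^sub>E carrier G"
    "twisted_act m n (g, \<gamma>) \<phi> = \<psi>"
    "twisted_pull G par m n \<phi> (g, \<gamma>) = (\<lambda>j\<in>{..m}. g (\<phi> j), q)"
proof -
  obtain g \<gamma> where g: "x = (g, \<gamma>)" "g \<in> {..n} \<rightarrow>\<^sub>E carrier G" "\<gamma> permutes {..n}"
    using x by (auto simp: wreath_simps)
  obtain \<psi> q where cr: "fibre_cross m n (\<lambda>k. par (g k) = -1) \<gamma> \<phi> \<psi> q"
    using fibre_cross_exists[OF g(3) \<phi>] by blast
  have "\<psi> \<in> Delta m n" "q permutes {..m}" using cr by (auto simp: fibre_cross_def)
  moreover have "(\<lambda>j\<in>{..m}. g (\<phi> j)) \<in> {..m} \<rightarrow>\<^sub>E carrier G"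
    using g(2) Delta_le[OF \<phi>] by auto
  ultimately show thesis
    using that g cr twisted_eq_of_fibre_cross[OF G g(2,3) \<phi> cr] by blast
qed

text \<open>Brings multiplicativity of a parity into the exclusive-or form of
  \<open>fibre_cross_mult\<close>.\<close>

lemma hom_sign_img_mult_odd_iff:
  assumes "par \<in> hom G sign_img" and "x \<in> carrier G" and "y \<in> carrier G"
  shows "par (x \<otimes>\<^bsub>G\<^esub> y) = -1 \<longleftrightarrow> (par x = -1) \<noteq> (par y = -1)"
proof -
  have "par x \<in> {-1, 1}" "par y \<in> {-1, 1}" "par (x \<otimes>\<^bsub>G\<^esub> y) = par x * par y"
    using assms by (auto simp: hom_def sign_img_def)
  then show ?thesis by auto
qed

text \<open>For each law a crossing of the compound element or compound map is assembled from
  crossings of its parts; \<open>twisted_eq_of_fibre_cross\<close> then identifies both operations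
  at once.\<close>

lemma crossed_operations_twisted:
  assumes G: "group G" and par: "par \<in> hom G sign_img"
  shows "crossed_operations (wreath G) twisted_act (twisted_pull G par)"
proof -
  interpret G: group G by (rule G)
  \<comment> \<open>For the product of the unit with itself the exclusive or compares a truth value
    with itself, hence is false.\<close>
  have par_one: "par \<one>\<^bsub>G\<^esub> \<noteq> -1"
    using hom_sign_img_mult_odd_iff[OF par G.one_closed G.one_closed] by simp
  note twisted_eq = twisted_eq_of_fibre_cross[OF G]
  note crossE = twisted_cases[OF G, where par = par]
  show ?thesis
  proof (rule crossed_operations.intro)
    show "group (wreath G n)" for n by (rule group_wreath[OF G])
  next
    fix \<phi> m n x assume \<phi>: "\<phi> \<in> Delta m n" and x: "x \<in> carrier (wreath G n)"
    show "twisted_act m n x \<phi> \<in> Delta m n"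
      "twisted_pull G par m n \<phi> x \<in> carrier (wreath G m)"
      by (rule crossE[OF x \<phi>], simp add: wreath_simps)+
  next
    fix \<phi> m n assume \<phi>: "\<phi> \<in> Delta m n"
    have one: "(\<lambda>i\<in>{..n}. \<one>\<^bsub>G\<^esub>) \<in> {..n} \<rightarrow>\<^sub>E carrier G" by auto
    have cr: "fibre_cross m n (\<lambda>k. par ((\<lambda>i\<in>{..n}. \<one>\<^bsub>G\<^esub>) k) = -1) id \<phi> \<phi> id"
      by (rule fibre_cross_cong[OF \<phi> _ fibre_cross_id_perm[OF \<phi>]]) (simp add: par_one)
    show "twisted_act m n \<one>\<^bsub>wreath G n\<^esub> \<phi> = \<phi>"
      "twisted_pull G par m n \<phi> \<one>\<^bsub>wreath G n\<^esub> = \<one>\<^bsub>wreath G m\<^esub>"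
      using twisted_eq[where par = par and g = "\<lambda>i\<in>{..n}. \<one>\<^bsub>G\<^esub>" and \<gamma> = id, OF one permutes_id \<phi> cr] Delta_le[OF \<phi>]
      by (auto simp: wreath_simps intro!: restrict_ext)
  next
    fix x n assume "x \<in> carrier (wreath G n)"
    then obtain g \<gamma> where x: "x = (g, \<gamma>)" "g \<in> {..n} \<rightarrow>\<^sub>E carrier G" "\<gamma> permutes {..n}"
      by (auto simp: wreath_simps)
    have "(\<lambda>j\<in>{..n}. g (restrict id {..n} j)) = g"
      using x(2) by (auto simp: PiE_iff intro!: extensionalityI[of _ "{..n}"])
    then show "twisted_act n n x (restrict id {..n}) = restrict id {..n}"
      "twisted_pull G par n n (restrict id {..n}) x = x"
      using twisted_eq[where par = par, OF x(2,3) id_in_Delta fibre_cross_id_map[OF x(3)]] x(1) by simp_all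
  next
    fix \<phi> m n x y
    assume \<phi>: "\<phi> \<in> Delta m n" and x: "x \<in> carrier (wreath G n)" and y: "y \<in> carrier (wreath G n)"
    obtain g \<gamma> \<psi> q where g: "x = (g, \<gamma>)" "g \<in> {..n} \<rightarrow>\<^sub>E carrier G" "\<gamma> permutes {..n}"
        "fibre_cross m n (\<lambda>k. par (g k) = -1) \<gamma> \<phi> \<psi> q" "\<psi> \<in> Delta m n" "q permutes {..m}"
        "twisted_act m n (g, \<gamma>) \<phi> = \<psi>"
        "twisted_pull G par m n \<phi> (g, \<gamma>) = (\<lambda>j\<in>{..m}. g (\<phi> j), q)"
      by (rule crossE[OF x \<phi>])
    obtain h \<delta> \<psi>' q' where h: "y = (h, \<delta>)" "h \<in> {..n} \<rightarrow>\<^sub>E carrier G" "\<delta> permutes {..n}"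
        "fibre_cross m n (\<lambda>k. par (h k) = -1) \<delta> \<psi> \<psi>' q'"
        "twisted_act m n (h, \<delta>) \<psi> = \<psi>'"
        "twisted_pull G par m n \<psi> (h, \<delta>) = (\<lambda>j\<in>{..m}. h (\<psi> j), q')"
      by (rule crossE[OF y g(5)])
    let ?gh = "\<lambda>i\<in>{..n}. g i \<otimes>\<^bsub>G\<^esub> h (Hilbert_Choice.inv \<gamma> i)"
    have le: "i \<le> n \<Longrightarrow> Hilbert_Choice.inv \<gamma> i \<le> n" for i
      by (rule permutes_atMost_le[OF permutes_inv[OF g(3)]])
    have gh: "?gh \<in> {..n} \<rightarrow>\<^sub>E carrier G" using g(2) h(2) le by auto
    have cr: "fibre_cross m n (\<lambda>k. par (?gh k) = -1) (\<gamma> \<circ> \<delta>) \<phi> \<psi>' (q \<circ> q')"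
    proof (rule fibre_cross_cong[OF \<phi> _ fibre_cross_mult[OF g(3) \<phi> g(4) h(4)]])
      fix k assume "k \<le> n"
      then show "((par (g k) = -1) \<noteq> (par (h (Hilbert_Choice.inv \<gamma> k)) = -1)) = (par (?gh k) = -1)"
        using hom_sign_img_mult_odd_iff[OF par, of "g k" "h (Hilbert_Choice.inv \<gamma> k)"] g(2) h(2) le
        by auto
    qed
    note eq = twisted_eq[where par = par and g = ?gh, OF gh permutes_compose[OF h(3) g(3)] \<phi> cr]
    show "twisted_act m n (x \<otimes>\<^bsub>wreath G n\<^esub> y) \<phi> = twisted_act m n y (twisted_act m n x \<phi>)"
      using eq(1) g(1,7) h(1,5) by (simp add: wreath_simps)
    \<comment> \<open>The commutation condition read backwards. It matches the two shifts of
      \<open>h\<close>: by \<open>\<gamma>\<close> before pulling back and by \<open>q\<close> after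
      it.\<close>
    have "Hilbert_Choice.inv \<gamma> (\<phi> j) = \<psi> (Hilbert_Choice.inv q j)"
      "Hilbert_Choice.inv q j \<le> m" if "j \<le> m" for j
    proof -
      show le: "Hilbert_Choice.inv q j \<le> m"
        by (rule permutes_atMost_le[OF permutes_inv[OF g(6)] that])
      have "\<gamma> (\<psi> (Hilbert_Choice.inv q j)) = \<phi> j"
        using g(4) le permutes_inverses(1)[OF g(6)] by (simp add: fibre_cross_def)
      then show "Hilbert_Choice.inv \<gamma> (\<phi> j) = \<psi> (Hilbert_Choice.inv q j)"
        using permutes_inv_eq[OF g(3)] by simp
    qed
    then show "twisted_pull G par m n \<phi> (x \<otimes>\<^bsub>wreath G n\<^esub> y) =
        twisted_pull G par m n \<phi> x \<otimes>\<^bsub>wreath G m\<^esub>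
          twisted_pull G par m n (twisted_act m n x \<phi>) y"
      using eq(2) g(1,7,8) h(1,6) Delta_le[OF \<phi>]
      by (auto simp: wreath_simps intro!: restrict_ext)
  next
    fix \<chi> l m \<phi> n x
    assume \<chi>: "\<chi> \<in> Delta l m" and \<phi>: "\<phi> \<in> Delta m n" and x: "x \<in> carrier (wreath G n)"
    obtain g \<gamma> \<psi> q where g: "x = (g, \<gamma>)" "g \<in> {..n} \<rightarrow>\<^sub>E carrier G" "\<gamma> permutes {..n}"
        "fibre_cross m n (\<lambda>k. par (g k) = -1) \<gamma> \<phi> \<psi> q" "q permutes {..m}"
        "(\<lambda>j\<in>{..m}. g (\<phi> j)) \<in> {..m} \<rightarrow>\<^sub>E carrier G"
        "twisted_act m n (g, \<gamma>) \<phi> = \<psi>"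
        "twisted_pull G par m n \<phi> (g, \<gamma>) = (\<lambda>j\<in>{..m}. g (\<phi> j), q)"
      by (rule crossE[OF x \<phi>])
    have "(\<lambda>j\<in>{..m}. g (\<phi> j), q) \<in> carrier (wreath G m)"
      using g(5,6) by (simp add: wreath_simps)
    then obtain \<omega> r where r: "fibre_cross l m (\<lambda>k. par ((\<lambda>j\<in>{..m}. g (\<phi> j)) k) = -1) q \<chi> \<omega> r"
        "twisted_act l m (\<lambda>j\<in>{..m}. g (\<phi> j), q) \<chi> = \<omega>"
        "twisted_pull G par l m \<chi> (\<lambda>j\<in>{..m}. g (\<phi> j), q) =
          (\<lambda>i\<in>{..l}. (\<lambda>j\<in>{..m}. g (\<phi> j)) (\<chi> i), r)"
      by (rule crossE[OF _ \<chi>]) auto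
    have cr: "fibre_cross l m (\<lambda>k. par (g (\<phi> k)) = -1) q \<chi> \<omega> r"
      by (rule fibre_cross_cong[OF \<chi> _ r(1)]) simp
    note eq = twisted_eq[OF g(2,3) compose_in_Delta[OF \<chi> \<phi>] fibre_cross_compose[OF \<phi> \<chi> g(4) cr]]
    show "twisted_act l n x (compose {..l} \<phi> \<chi>) =
        compose {..l} (twisted_act m n x \<phi>) (twisted_act l m (twisted_pull G par m n \<phi> x) \<chi>)"
      using eq(1) g(1,7,8) r(2) by simp
    show "twisted_pull G par l n (compose {..l} \<phi> \<chi>) x =
        twisted_pull G par l m \<chi> (twisted_pull G par m n \<phi> x)"
      using eq(2) g(1,8) r(3) Delta_le[OF \<chi>]
      by (auto simp: compose_apply intro!: restrict_ext)
  qed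
qed

lemma csg_twisted_symmetric:
  "group G \<Longrightarrow> par \<in> hom G sign_img \<Longrightarrow> crossed_simplicial_group (twisted_symmetric G par)"
  unfolding twisted_symmetric_def
  by (rule crossed_operations.csg_P[OF crossed_operations_twisted])

lemma grp_twisted_symmetric: "grp (twisted_symmetric G par) = wreath G"
  by (simp add: twisted_symmetric_def crossed_product_def)

lemma twisted_symmetric_eq_of_fibre_cross:
  assumes "group G" and "par \<in> hom G sign_img"
    and g: "g \<in> {..n} \<rightarrow>\<^sub>E carrier G" and \<gamma>: "\<gamma> permutes {..n}"
    and \<phi>: "\<phi> \<in> Delta m n" and cr: "fibre_cross m n (\<lambda>k. par (g k) = -1) \<gamma> \<phi> \<psi> q"
  shows "act (twisted_symmetric G par) m n (g, \<gamma>) \<phi> = \<psi>"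
    and "pull (twisted_symmetric G par) m n \<phi> (g, \<gamma>) = (\<lambda>j\<in>{..m}. g (\<phi> j), q)"
proof -
  interpret crossed_operations "wreath G" twisted_act "twisted_pull G par"
    by (rule crossed_operations_twisted[OF assms(1,2)])
  have "(g, \<gamma>) \<in> carrier (wreath G n)" using g \<gamma> by (simp add: wreath_simps)
  then show "act (twisted_symmetric G par) m n (g, \<gamma>) \<phi> = \<psi>"
    "pull (twisted_symmetric G par) m n \<phi> (g, \<gamma>) = (\<lambda>j\<in>{..m}. g (\<phi> j), q)"
    using act_P[OF \<phi>] pull_P[OF \<phi>] twisted_eq_of_fibre_cross[OF assms(1) g \<gamma> \<phi> cr]
    by (simp_all add: twisted_symmetric_def)
qed

section \<open>Functoriality in the group with parity\<close>

lemma wreath_map_hom: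
  assumes "f \<in> hom G H"
  shows "wreath_map f n \<in> hom (wreath G n) (wreath H n)"
proof (rule homI)
  fix x assume "x \<in> carrier (wreath G n)"
  then show "wreath_map f n x \<in> carrier (wreath H n)"
    using assms by (auto simp: wreath_simps wreath_map_def hom_def)
next
  fix x y assume "x \<in> carrier (wreath G n)" "y \<in> carrier (wreath G n)"
  then show "wreath_map f n (x \<otimes>\<^bsub>wreath G n\<^esub> y) =
      wreath_map f n x \<otimes>\<^bsub>wreath H n\<^esub> wreath_map f n y"
    using assms permutes_atMost_le[OF permutes_inv]
    by (auto simp: wreath_simps wreath_map_def hom_def PiE_iff intro!: restrict_ext)
qed

text \<open>A crossing depends on the labels only through their parities, which \<open>f\<close>
  preserves, so one pair \<open>\<psi>\<close>, \<open>q\<close> serves both groups.\<close>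

lemma
  assumes G: "group G" "par \<in> hom G sign_img" and H: "group H" "par' \<in> hom H sign_img"
    and f: "f \<in> hom G H" and compat: "\<And>x. x \<in> carrier G \<Longrightarrow> par' (f x) = par x"
    and x: "x \<in> carrier (wreath G n)" and \<phi>: "\<phi> \<in> Delta m n"
  shows act_wreath_map:
      "act (twisted_symmetric H par') m n (wreath_map f n x) \<phi> =
        act (twisted_symmetric G par) m n x \<phi>"
    and pull_wreath_map:
      "pull (twisted_symmetric H par') m n \<phi> (wreath_map f n x) =
        wreath_map f m (pull (twisted_symmetric G par) m n \<phi> x)"
proof -
  obtain g \<gamma> where g: "x = (g, \<gamma>)" "g \<in> {..n} \<rightarrow>\<^sub>E carrier G" "\<gamma> permutes {..n}"
    using x by (auto simp: wreath_simps)
  obtain \<psi> q where cr: "fibre_cross m n (\<lambda>k. par (g k) = -1) \<gamma> \<phi> \<psi> q"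
    using fibre_cross_exists[OF g(3) \<phi>] by blast
  let ?fg = "\<lambda>i\<in>{..n}. f (g i)"
  have fg: "?fg \<in> {..n} \<rightarrow>\<^sub>E carrier H" using g(2) f by (auto simp: hom_def)
  have cr': "fibre_cross m n (\<lambda>k. par' (?fg k) = -1) \<gamma> \<phi> \<psi> q"
    using g(2) by (intro fibre_cross_cong[OF \<phi> _ cr]) (auto simp: compat PiE_iff)
  show "act (twisted_symmetric H par') m n (wreath_map f n x) \<phi> =
        act (twisted_symmetric G par) m n x \<phi>"
    "pull (twisted_symmetric H par') m n \<phi> (wreath_map f n x) =
        wreath_map f m (pull (twisted_symmetric G par) m n \<phi> x)"
    using twisted_symmetric_eq_of_fibre_cross[OF G g(2,3) \<phi> cr]
      twisted_symmetric_eq_of_fibre_cross[where par = par' and g = ?fg, OF H fg g(3) \<phi> cr'] g(1) Delta_le[OF \<phi>]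
    by (auto simp: wreath_map_def intro!: restrict_ext)
qed

lemma csg_functor_twisted_symmetric_map:
  assumes G: "group G" "par \<in> hom G sign_img" and H: "group H" "par' \<in> hom H sign_img"
    and f: "f \<in> hom G H" and compat: "\<And>x. x \<in> carrier G \<Longrightarrow> par' (f x) = par x"
  shows "csg_functor (twisted_symmetric G par) (twisted_symmetric H par') (wreath_map f)
    (twisted_symmetric_map G par H par' f)"
  unfolding twisted_symmetric_map_def
proof (rule csg_functor_induced)
qed (simp_all add: csg_twisted_symmetric G H grp_twisted_symmetric wreath_map_hom[OF f]
    act_wreath_map[OF assms] pull_wreath_map[OF assms])

section \<open>The action on vertices and edges\<close>

lemma vertex_in_Delta: "i \<le> n \<Longrightarrow> vertex i \<in> Delta 0 n"
  by (simp add: Delta_iff vertex_def)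

lemma vertex_apply: "vertex i 0 = i"
  by (simp add: vertex_def)

lemma vertex_eq_iff: "vertex i = vertex j \<longleftrightarrow> i = j"
  by (metis vertex_apply)

lemma Delta_0_eq_vertex: "\<phi> \<in> Delta 0 n \<Longrightarrow> \<phi> = vertex (\<phi> 0)"
  by (rule extensionalityI[of _ "{..0}"]) (auto simp: Delta_iff vertex_def)

lemma compose_vertex: "compose {..0} \<phi> (vertex j) = vertex (\<phi> j)"
  by (rule extensionalityI[of _ "{..0}"]) (auto simp: vertex_def compose_eq)

lemma coface0_eq_vertex: "coface0 0 = vertex 1" "coface0 (Suc 0) = vertex 0"
  by (auto simp: coface0_def vertex_def)

lemma codegeneracy0_in_Delta: "codegeneracy0 \<in> Delta (Suc 0) 0"
  by (simp add: Delta_iff codegeneracy0_def)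

text \<open>The parity condition is moved from \<open>q\<close> on fibres of \<open>\<psi>\<close>
  to the inverse of \<open>q\<close> on fibres of \<open>\<phi>\<close>. This suits
  \<open>theta\<close>, which is specified through its inverse.\<close>

lemma fibre_crossI_inv:
  assumes \<psi>: "\<psi> \<in> Delta m n" and q: "q permutes {..m}"
    and comm: "\<And>j. j \<le> m \<Longrightarrow> \<gamma> (\<psi> j) = \<phi> (q j)"
    and fib: "\<And>a b. a < b \<Longrightarrow> b \<le> m \<Longrightarrow> \<phi> a = \<phi> b \<Longrightarrow>
      Hilbert_Choice.inv q a < Hilbert_Choice.inv q b \<longleftrightarrow> \<not> \<epsilon> (\<phi> a)"
  shows "fibre_cross m n \<epsilon> \<gamma> \<phi> \<psi> q"
  unfolding fibre_cross_def
proof (intro conjI allI impI)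
  fix i j assume ij: "i \<le> m" "j \<le> m" "i < j" "\<psi> i = \<psi> j"
  have eq: "\<phi> (q i) = \<phi> (q j)" using comm ij by metis
  have le: "q i \<le> m" "q j \<le> m" using ij permutes_atMost_le[OF q] by auto
  have inv: "Hilbert_Choice.inv q (q i) = i" "Hilbert_Choice.inv q (q j) = j"
    using permutes_inverses(2)[OF q] by auto
  have "q i \<noteq> q j" using inv ij(3) by (metis less_irrefl)
  then consider "q i < q j" | "q j < q i" by linarith
  then show "(q i < q j) = (\<not> \<epsilon> (\<phi> (q i)))"
  proof cases
    case 1
    then show ?thesis using fib[OF 1 le(2) eq] inv ij(3) by simp
  next
    case 2
    then show ?thesis using fib[OF 2 le(1) eq[symmetric]] inv ij(3) eq by simp
  qed
qed (use \<psi> q comm in auto)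

context crossed_simplicial_group
begin

text \<open>The elements of \<open>grp X n\<close> act on the vertices from the right, and a group
  acts by bijections; this makes the description defining \<open>theta\<close> meaningful.\<close>

lemma theta_properties:
  assumes g: "g \<in> carrier (grp X n)"
  shows theta_permutes: "theta X n g permutes {..n}"
    and act_vertex: "\<And>i. i \<le> n \<Longrightarrow> act X 0 n g (vertex i) = vertex (Hilbert_Choice.inv (theta X n g) i)"
    and theta_unique: "\<And>p. p permutes {..n} \<Longrightarrow>
      (\<And>i. i \<le> n \<Longrightarrow> act X 0 n g (vertex i) = vertex (Hilbert_Choice.inv p i)) \<Longrightarrow>
      theta X n g = p"
proof -
  interpret G: group "grp X n" by (rule group_grp)
  \<comment> \<open>The permutation of vertices induced by \<open>h\<close>, extended by fixed
    points; \<open>theta\<close> will be its inverse.\<close>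
  define r where "r h i = (if i \<le> n then act X 0 n h (vertex i) 0 else i)" for h i
  have act_r: "act X 0 n h (vertex i) = vertex (r h i)" "r h i \<le> n"
    if "h \<in> carrier (grp X n)" "i \<le> n" for h i
    using act_in[OF vertex_in_Delta[OF that(2)] that(1)] that(2)
    by (auto simp: r_def Delta_0_eq_vertex[symmetric] Delta_le)
  have r_mult: "r (h \<otimes>\<^bsub>grp X n\<^esub> k) i = r k (r h i)"
    if "h \<in> carrier (grp X n)" "k \<in> carrier (grp X n)" "i \<le> n" for h k i
  proof -
    have "vertex (r (h \<otimes>\<^bsub>grp X n\<^esub> k) i) = vertex (r k (r h i))"
      using act_mult[OF vertex_in_Delta[OF that(3)] that(1,2)] that by (simp add: act_r)
    then show ?thesis by (simp add: vertex_eq_iff)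
  qed
  have r_one: "r \<one>\<^bsub>grp X n\<^esub> i = i" for i
    using act_one[OF vertex_in_Delta[of i n]] by (simp add: r_def vertex_apply)
  have r_perm: "r g permutes {..n}"
  proof (rule bij_imp_permutes)
    show "bij_betw (r g) {..n} {..n}"
      using r_mult[OF g G.inv_closed[OF g]] r_mult[OF G.inv_closed[OF g] g] act_r(2) g
      by (intro bij_betw_byWitness[where f' = "r (inv\<^bsub>grp X n\<^esub> g)"]) (auto simp: r_one)
  qed (simp add: r_def)
  have ex1: "\<exists>!p. p permutes {..n} \<and>
      (\<forall>i\<le>n. act X 0 n g (vertex i) = vertex (Hilbert_Choice.inv p i))"
  proof (rule ex1I[of _ "Hilbert_Choice.inv (r g)"])
    show "Hilbert_Choice.inv (r g) permutes {..n} \<and> (\<forall>i\<le>n. act X 0 n g (vertex i) =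
        vertex (Hilbert_Choice.inv (Hilbert_Choice.inv (r g)) i))"
      using r_perm act_r(1)[OF g] by (simp add: permutes_inv permutes_inv_inv)
  next
    fix p assume p: "p permutes {..n} \<and>
        (\<forall>i\<le>n. act X 0 n g (vertex i) = vertex (Hilbert_Choice.inv p i))"
    have "Hilbert_Choice.inv p i = r g i" for i
    proof (cases "i \<le> n")
      case True
      then show ?thesis using p act_r(1)[OF g True] by (simp add: vertex_eq_iff)
    next
      case False
      then show ?thesis using p permutes_not_in[OF permutes_inv, of p "{..n}" i] by (simp add: r_def)
    qed
    then have "Hilbert_Choice.inv p = r g" by auto
    then show "p = Hilbert_Choice.inv (r g)" using p permutes_inv_inv by metis
  qed
  have "theta X n g permutes {..n} \<and> (\<forall>i\<le>n. act X 0 n g (vertex i) =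
      vertex (Hilbert_Choice.inv (theta X n g) i))"
    using theI'[OF ex1] unfolding theta_def .
  then show "theta X n g permutes {..n}"
    "\<And>i. i \<le> n \<Longrightarrow> act X 0 n g (vertex i) = vertex (Hilbert_Choice.inv (theta X n g) i)"
    by simp_all
  show "theta X n g = p" if "p permutes {..n}"
    "\<And>i. i \<le> n \<Longrightarrow> act X 0 n g (vertex i) = vertex (Hilbert_Choice.inv p i)" for p
    unfolding theta_def by (rule the1_equality[OF ex1]) (use that in blast)
qed

lemma inv_theta_le:
  "g \<in> carrier (grp X n) \<Longrightarrow> i \<le> n \<Longrightarrow> Hilbert_Choice.inv (theta X n g) i \<le> n"
  by (rule permutes_atMost_le[OF permutes_inv[OF theta_permutes]])

text \<open>Two reversals cancel: the action on vertices is a right action, and \<open>theta\<close>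
  is the inverse of the permutation it gives.\<close>

lemma theta_mult:
  assumes g: "g \<in> carrier (grp X n)" and h: "h \<in> carrier (grp X n)"
  shows "theta X n (g \<otimes>\<^bsub>grp X n\<^esub> h) = theta X n g \<circ> theta X n h"
proof (rule theta_unique)
  show "g \<otimes>\<^bsub>grp X n\<^esub> h \<in> carrier (grp X n)" using g h by simp
  show "theta X n g \<circ> theta X n h permutes {..n}"
    by (rule permutes_compose[OF theta_permutes[OF h] theta_permutes[OF g]])
  fix i assume i: "i \<le> n"
  have "act X 0 n (g \<otimes>\<^bsub>grp X n\<^esub> h) (vertex i) =
      vertex (Hilbert_Choice.inv (theta X n h) (Hilbert_Choice.inv (theta X n g) i))"
    using act_mult[OF vertex_in_Delta[OF i] g h] act_vertex[OF g i]
      act_vertex[OF h inv_theta_le[OF g i]] by simp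
  then show "act X 0 n (g \<otimes>\<^bsub>grp X n\<^esub> h) (vertex i) =
      vertex (Hilbert_Choice.inv (theta X n g \<circ> theta X n h) i)"
    using permutes_bij[OF theta_permutes[OF g]] permutes_bij[OF theta_permutes[OF h]]
    by (simp add: o_inv_distrib)
qed

text \<open>In \<open>pull_mult\<close> the second factor is pulled back along the vertex to which
  \<open>g\<close> has moved \<open>vertex i\<close>, which by \<open>act_vertex\<close> is the
  index shift of the wreath product.\<close>

lemma L_map_hom: "L_map X n \<in> hom (grp X n) (wreath (grp X 0) n)"
proof (rule homI)
  fix g assume "g \<in> carrier (grp X n)"
  then show "L_map X n g \<in> carrier (wreath (grp X 0) n)"
    by (auto simp: L_map_def wreath_simps theta_permutes pull_in vertex_in_Delta)
next
  fix g h assume gh: "g \<in> carrier (grp X n)" "h \<in> carrier (grp X n)"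
  have "pull X 0 n (vertex i) (g \<otimes>\<^bsub>grp X n\<^esub> h) = pull X 0 n (vertex i) g \<otimes>\<^bsub>grp X 0\<^esub>
      pull X 0 n (vertex (Hilbert_Choice.inv (theta X n g) i)) h" if "i \<le> n" for i
    using pull_mult[OF vertex_in_Delta[OF that] gh] act_vertex[OF gh(1) that] by simp
  then show "L_map X n (g \<otimes>\<^bsub>grp X n\<^esub> h) = L_map X n g \<otimes>\<^bsub>wreath (grp X 0) n\<^esub> L_map X n h"
    using inv_theta_le[OF gh(1)]
    by (auto simp: L_map_def wreath_simps theta_mult gh intro!: restrict_ext)
qed

text \<open>These are \<open>act_compose\<close> and \<open>pull_compose\<close> with a vertex as
  the inner map: composing \<open>\<phi>\<close> with \<open>vertex j\<close> gives
  \<open>vertex (\<phi> j)\<close>.\<close>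

lemma
  assumes \<phi>: "\<phi> \<in> Delta m n" and g: "g \<in> carrier (grp X n)" and j: "j \<le> m"
  shows inv_theta_pull: "act X m n g \<phi> (Hilbert_Choice.inv (theta X m (pull X m n \<phi> g)) j) =
      Hilbert_Choice.inv (theta X n g) (\<phi> j)"
    and pull_vertex_pull: "pull X 0 m (vertex j) (pull X m n \<phi> g) = pull X 0 n (vertex (\<phi> j)) g"
proof -
  have "vertex (act X m n g \<phi> (Hilbert_Choice.inv (theta X m (pull X m n \<phi> g)) j)) =
      vertex (Hilbert_Choice.inv (theta X n g) (\<phi> j))"
    using act_compose[OF vertex_in_Delta[OF j] \<phi> g, unfolded compose_vertex] act_vertex[OF pull_in[OF \<phi> g] j]
      act_vertex[OF g Delta_le[OF \<phi> j]] by (simp only: compose_vertex)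
  then show "act X m n g \<phi> (Hilbert_Choice.inv (theta X m (pull X m n \<phi> g)) j) =
      Hilbert_Choice.inv (theta X n g) (\<phi> j)" by (simp add: vertex_eq_iff)
  show "pull X 0 m (vertex j) (pull X m n \<phi> g) = pull X 0 n (vertex (\<phi> j)) g"
    using pull_compose[OF vertex_in_Delta[OF j] \<phi> g] by (simp only: compose_vertex)
qed

text \<open>As maps from [0] to [1], \<delta>_0 is the vertex 1 and \<delta>_1 the vertex 0. The
  image of vertex 1 is again one of these two, so the \<open>undefined\<close> branch of
  \<open>lambda0\<close> is never reached.\<close>

lemma lambda0_eq:
  assumes g: "g \<in> carrier (grp X 0)"
  shows "lambda0 X g =
    (if Hilbert_Choice.inv (theta X 1 (pull X 1 0 codegeneracy0 g)) 1 = 1 then 1 else -1)"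
proof -
  have s: "pull X 1 0 codegeneracy0 g \<in> carrier (grp X 1)"
    using pull_in[OF codegeneracy0_in_Delta g] by simp
  show ?thesis
    using act_vertex[OF s, of 1] inv_theta_le[OF s, of 1]
    by (auto simp: lambda0_def Let_def coface0_eq_vertex vertex_eq_iff)
qed

text \<open>\<lambda>_0 is the pullback along \<sigma>_0 followed by \<open>theta\<close> and the
  sign of a permutation of two points. Multiplicativity of the pullback is the point to check, since
  \<open>pull_mult\<close> gives only a twisted law.\<close>

lemma lambda0_hom: "lambda0 X \<in> hom (grp X 0) sign_img"
proof (rule homI)
  fix g assume "g \<in> carrier (grp X 0)"
  then show "lambda0 X g \<in> carrier sign_img" by (simp add: lambda0_eq sign_img_def)
next
  fix g h assume g: "g \<in> carrier (grp X 0)" and h: "h \<in> carrier (grp X 0)"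
  define s where "s k = pull X 1 0 codegeneracy0 k" for k
  note \<sigma> = codegeneracy0_in_Delta[folded One_nat_def]
  have s: "s g \<in> carrier (grp X 1)" "s h \<in> carrier (grp X 1)"
    using pull_in[OF \<sigma>] g h by (simp_all add: s_def)
  \<comment> \<open>[0] is terminal in the simplex category, so the twist in
    \<open>pull_mult\<close> disappears.\<close>
  have "act X 1 0 g codegeneracy0 = codegeneracy0"
    by (rule Delta_eqI[OF act_in[OF \<sigma> g] \<sigma>])
      (use Delta_le[OF act_in[OF \<sigma> g]] Delta_le[OF \<sigma>] in fastforce)
  then have s_mult: "s (g \<otimes>\<^bsub>grp X 0\<^esub> h) = s g \<otimes>\<^bsub>grp X 1\<^esub> s h"
    using pull_mult[OF \<sigma> g h] by (simp add: s_def)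
  let ?r = "\<lambda>k. Hilbert_Choice.inv (theta X 1 (s k))"
  have r: "?r (g \<otimes>\<^bsub>grp X 0\<^esub> h) 1 = ?r h (?r g 1)"
    using permutes_bij[OF theta_permutes[OF s(1)]] permutes_bij[OF theta_permutes[OF s(2)]]
    unfolding s_mult theta_mult[OF s] by (simp add: o_inv_distrib)
  have ne: "?r h 0 \<noteq> ?r h 1"
    using permutes_inj[OF permutes_inv[OF theta_permutes[OF s(2)]]] by (auto dest: injD)
  have "?r g 1 = 0 \<or> ?r g 1 = 1" "?r h 0 = 0 \<or> ?r h 0 = 1" "?r h 1 = 0 \<or> ?r h 1 = 1"
    using inv_theta_le[OF s(1), of 1] inv_theta_le[OF s(2), of 0] inv_theta_le[OF s(2), of 1]
    by linarith+
  moreover have "lambda0 X k = (if ?r k 1 = 1 then 1 else -1)" if "k \<in> carrier (grp X 0)" for k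
    using lambda0_eq[OF that] by (simp add: s_def)
  ultimately show "lambda0 X (g \<otimes>\<^bsub>grp X 0\<^esub> h) = lambda0 X g \<otimes>\<^bsub>sign_img\<^esub> lambda0 X h"
    using g h ne r by (auto simp: sign_img_def)
qed

text \<open>An edge \<open>a < b\<close> inside a fibre of \<open>\<phi>\<close> is pulled back to a degenerate edge of the target, so
  the element it carries is pulled back along the codegeneracy from the vertex of that fibre. This
  element of \<open>grp X 1\<close> either fixes or reverses the edge, and its parity decides which.\<close>

lemma fibre_cross_theta:
  assumes \<phi>: "\<phi> \<in> Delta m n" and g: "g \<in> carrier (grp X n)"
  shows "fibre_cross m n (\<lambda>k. lambda0 X (pull X 0 n (vertex k) g) = -1) (theta X n g) \<phi>
    (act X m n g \<phi>) (theta X m (pull X m n \<phi> g))"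
proof (rule fibre_crossI_inv)
  let ?h = "pull X m n \<phi> g"
  let ?r = "Hilbert_Choice.inv (theta X m ?h)"
  have h: "?h \<in> carrier (grp X m)" by (rule pull_in[OF \<phi> g])
  show "act X m n g \<phi> \<in> Delta m n" by (rule act_in[OF \<phi> g])
  show "theta X m ?h permutes {..m}" by (rule theta_permutes[OF h])
  show "theta X n g (act X m n g \<phi> j) = \<phi> (theta X m ?h j)" if "j \<le> m" for j
  proof -
    have "theta X m ?h j \<le> m" using permutes_atMost_le[OF theta_permutes[OF h] that] .
    from inv_theta_pull[OF \<phi> g this]
    have "act X m n g \<phi> j = Hilbert_Choice.inv (theta X n g) (\<phi> (theta X m ?h j))"
      by (simp add: permutes_inverses(2)[OF theta_permutes[OF h]])
    then show ?thesis by (simp add: permutes_inverses(1)[OF theta_permutes[OF g]])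
  qed
  fix a b assume ab: "a < b" "b \<le> m" "\<phi> a = \<phi> b"
  define \<alpha> where "\<alpha> = (\<lambda>x\<in>{..1::nat}. if x = 0 then a else b)"
  define k where "k = pull X 0 n (vertex (\<phi> a)) g"
  define s where "s = pull X 1 0 codegeneracy0 k"
  note \<sigma> = codegeneracy0_in_Delta[folded One_nat_def]
  have \<phi>a: "\<phi> a \<le> n" using Delta_le[OF \<phi>, of a] ab by simp
  have k: "k \<in> carrier (grp X 0)"
    unfolding k_def by (rule pull_in[OF vertex_in_Delta[OF \<phi>a] g])
  have s: "s \<in> carrier (grp X 1)" unfolding s_def by (rule pull_in[OF \<sigma> k])
  have \<alpha>: "\<alpha> \<in> Delta 1 m" using ab by (auto simp: \<alpha>_def Delta_iff)
  have \<alpha>_ends: "\<alpha> 0 = a" "\<alpha> 1 = b" by (simp_all add: \<alpha>_def)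
  have "compose {..1} \<phi> \<alpha> = compose {..1} (vertex (\<phi> a)) codegeneracy0"
    using ab(3) by (intro extensionalityI[of _ "{..1}"])
      (auto simp: compose_eq \<alpha>_def codegeneracy0_def vertex_def)
  then have pull_\<alpha>: "pull X 1 m \<alpha> ?h = s"
    using pull_compose[OF \<alpha> \<phi> g] pull_compose[OF \<sigma> vertex_in_Delta[OF \<phi>a] g]
    by (simp add: s_def k_def)
  let ?t = "Hilbert_Choice.inv (theta X 1 s)"
  let ?\<beta> = "act X 1 m ?h \<alpha>"
  have \<beta>: "?\<beta> 0 \<le> ?\<beta> 1" using Delta_mono[OF act_in[OF \<alpha> h], of 0 1] by simp
  have r: "?r a = ?\<beta> (?t 0)" "?r b = ?\<beta> (?t 1)"
    using inv_theta_pull[OF \<alpha> h, of 0] inv_theta_pull[OF \<alpha> h, of 1]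
    unfolding pull_\<alpha> \<alpha>_ends by simp_all
  \<comment> \<open>With this, \<open>?\<beta> 0 < ?\<beta> 1\<close> is strict, so
    \<open>?r a\<close> and \<open>?r b\<close> are ordered as \<open>?t 0\<close> and
    \<open>?t 1\<close> are, which is what \<open>lambda0\<close> detects.\<close>
  have "?r a \<noteq> ?r b"
    using ab(1) permutes_inj[OF permutes_inv[OF theta_permutes[OF h]]] by (auto dest: injD)
  moreover have "?t 0 \<noteq> ?t 1"
    using permutes_inj[OF permutes_inv[OF theta_permutes[OF s]]] by (auto dest: injD)
  moreover have "?t 0 = 0 \<or> ?t 0 = 1" "?t 1 = 0 \<or> ?t 1 = 1"
    using inv_theta_le[OF s, of 0] inv_theta_le[OF s, of 1] by linarith+
  moreover have "lambda0 X k = (if ?t 1 = 1 then 1 else -1)"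
    using lambda0_eq[OF k] by (simp add: s_def)
  ultimately show "(?r a < ?r b) = (lambda0 X (pull X 0 n (vertex (\<phi> a)) g) \<noteq> -1)"
    using \<beta> unfolding r k_def[symmetric] by auto
qed

end

section \<open>The canonical functors and their commuting triangle\<close>

text \<open>The labels of \<open>L_map X n g\<close> have exactly the parities occurring in
  \<open>fibre_cross_theta\<close>, so that crossing computes both operations; the repeated labels
  agree by \<open>pull_vertex_pull\<close>.\<close>

lemma (in crossed_simplicial_group)
  assumes g: "g \<in> carrier (grp X n)" and \<phi>: "\<phi> \<in> Delta m n"
  shows act_L_map: "act (associated_twisted_symmetric X) m n (L_map X n g) \<phi> = act X m n g \<phi>"
    and pull_L_map: "pull (associated_twisted_symmetric X) m n \<phi> (L_map X n g) =
      L_map X m (pull X m n \<phi> g)"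
proof -
  let ?l = "\<lambda>i\<in>{..n}. pull X 0 n (vertex i) g"
  have l: "?l \<in> {..n} \<rightarrow>\<^sub>E carrier (grp X 0)"
    using pull_in[OF vertex_in_Delta g] by auto
  have cr: "fibre_cross m n (\<lambda>k. lambda0 X (?l k) = -1) (theta X n g) \<phi>
      (act X m n g \<phi>) (theta X m (pull X m n \<phi> g))"
    by (rule fibre_cross_cong[OF \<phi> _ fibre_cross_theta[OF \<phi> g]]) simp
  note eq = twisted_symmetric_eq_of_fibre_cross[where par = "lambda0 X" and g = ?l,
      OF group_grp lambda0_hom l theta_permutes[OF g] \<phi> cr]
  show "act (associated_twisted_symmetric X) m n (L_map X n g) \<phi> = act X m n g \<phi>"
    using eq(1) by (simp add: associated_twisted_symmetric_def L_map_def)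
  have "(\<lambda>j\<in>{..m}. ?l (\<phi> j)) = (\<lambda>i\<in>{..m}. pull X 0 m (vertex i) (pull X m n \<phi> g))"
    using pull_vertex_pull[OF \<phi> g] Delta_le[OF \<phi>] by (intro restrict_ext) auto
  then show "pull (associated_twisted_symmetric X) m n \<phi> (L_map X n g) =
      L_map X m (pull X m n \<phi> g)"
    using eq(2) by (simp add: associated_twisted_symmetric_def L_map_def)
qed

theorem proposition2p22:
  fixes X :: "('a, 'g) csg"
  assumes "crossed_simplicial_group X"
  shows "csg_functor X (associated_twisted_symmetric X) (L_map X) (canonical_lambda_tilde X) \<and>
    csg_functor (associated_twisted_symmetric X) hyperoctahedral
      (wreath_map (lambda0 X)) (parity_functor X) \<and>
    csg_functor X hyperoctahedral (fl_component X) (canonical_lambda X) \<and>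
    (\<forall>m n. \<forall>u \<in> arrows X m n.
      canonical_lambda X m n u = parity_functor X m n (canonical_lambda_tilde X m n u))"
proof -
  interpret X: crossed_simplicial_group X by (rule assms)
  let ?T = "associated_twisted_symmetric X" and ?H = "hyperoctahedral"
  have id_hom: "id \<in> hom sign_img sign_img" by (auto simp: hom_def)
  have T: "crossed_simplicial_group ?T" and grpT: "grp ?T = wreath (grp X 0)"
    by (simp_all add: associated_twisted_symmetric_def csg_twisted_symmetric X.group_grp
        X.lambda0_hom grp_twisted_symmetric)
  have H: "crossed_simplicial_group ?H" and grpH: "grp ?H = wreath sign_img"
    by (simp_all add: hyperoctahedral_def csg_twisted_symmetric sign_img_is_group id_hom
        grp_twisted_symmetric)
  interpret T: crossed_simplicial_group ?T by (rule T)
  \<comment> \<open>\<open>lambda0 X\<close> enters twice, as the parity of the source group and as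
    the homomorphism to C_2. With \<open>id\<close> as the parity of C_2, compatibility is
    immediate.\<close>
  note parity = X.group_grp X.lambda0_hom sign_img_is_group id_hom X.lambda0_hom
  \<comment> \<open>This identity of components yields both the functoriality of \<lambda> and the
    factorization.\<close>
  have fl: "fl_component X n g = wreath_map (lambda0 X) n (L_map X n g)" for n g
    by (auto simp: fl_component_def wreath_map_def L_map_def intro!: restrict_ext)
  have L_in: "L_map X n g \<in> carrier (wreath (grp X 0) n)" if "g \<in> carrier (grp X n)" for n g
    using X.L_map_hom that by (auto simp: hom_def)
  have tilde: "csg_functor X ?T (L_map X) (canonical_lambda_tilde X)"
    unfolding canonical_lambda_tilde_def
    by (rule csg_functor_induced[OF assms T])
      (simp_all add: grpT X.L_map_hom X.act_L_map X.pull_L_map)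
  have par: "csg_functor ?T ?H (wreath_map (lambda0 X)) (parity_functor X)"
    unfolding associated_twisted_symmetric_def hyperoctahedral_def parity_functor_def
    by (rule csg_functor_twisted_symmetric_map[OF parity]) simp
  have fl_hom: "fl_component X n \<in> hom (grp X n) (grp ?H n)" for n
  proof -
    have "fl_component X n = wreath_map (lambda0 X) n \<circ> L_map X n" by (rule ext) (simp add: fl)
    then show ?thesis
      using hom_compose[OF X.L_map_hom wreath_map_hom[OF X.lambda0_hom]] by (simp add: grpH)
  qed
  have fl_functor: "csg_functor X ?H (fl_component X) (canonical_lambda X)"
    unfolding canonical_lambda_def
  proof (rule csg_functor_induced[OF assms H fl_hom])
    fix m n g \<phi> assume g: "g \<in> carrier (grp X n)" and \<phi>: "\<phi> \<in> Delta m n"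
    show "act ?H m n (fl_component X n g) \<phi> = act X m n g \<phi>"
      using act_wreath_map[OF parity _ L_in[OF g] \<phi>] X.act_L_map[OF g \<phi>]
      by (simp add: fl hyperoctahedral_def associated_twisted_symmetric_def)
    show "pull ?H m n \<phi> (fl_component X n g) = fl_component X m (pull X m n \<phi> g)"
      using pull_wreath_map[OF parity _ L_in[OF g] \<phi>] X.pull_L_map[OF g \<phi>]
      by (simp add: fl hyperoctahedral_def associated_twisted_symmetric_def)
  qed
  \<comment> \<open>The intermediate arrow already has the factorization
    \<open>(\<phi>, L_map X m g)\<close>, so the second functor only applies
    \<open>lambda0 X\<close> to the labels, and \<open>fl\<close> concludes.\<close>
  have "canonical_lambda X m n u = parity_functor X m n (canonical_lambda_tilde X m n u)"
    if "u \<in> arrows X m n" for m n u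
  proof -
    obtain \<phi> g where u: "\<phi> \<in> Delta m n" "g \<in> carrier (grp X m)"
      "u = cmp X m m n (incl X m n \<phi>) (aut X m g)"
      by (rule X.factorization_cases[OF \<open>u \<in> arrows X m n\<close>])
    show ?thesis
      using X.factorization_eq[OF u(1,2)] T.factorization_eq[OF u(1), of "L_map X m g"] L_in[OF u(2)]
      by (simp add: u(3) canonical_lambda_def canonical_lambda_tilde_def parity_functor_def
          twisted_symmetric_map_def induced_functor_def grpT fl
          hyperoctahedral_def[symmetric] associated_twisted_symmetric_def[symmetric])
  qed
  with tilde par fl_functor show ?thesis by blast
qed

end
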